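(* An elliptic family of bisectors is equitant if and only if it is real.
   Context: $V$ is a 3-dimensional $\mathbb C$-linear space with a hermitian form $\langle-,-\rangle$ (linear in the first argument) of signature $++-$; the same letter denotes a point of $\mathbb P_{\mathbb C}V$ and a representative in $V$. $\mathbb B=\{p\in\mathbb P_{\mathbb C}V\mid\langle p,p\rangle<0\}$. $\mathrm{Lin}_{\mathbb C}(V,V)$ is the space of $\mathbb C$-linear maps $V\to V$, $h^*$ is the adjoint of $h$, and $\langle-,v\rangle w$ denotes the map $x\mapsto\langle x,v\rangle w$. A family of bisectors is an $\mathbb R$-linear subspace $W\subset\mathrm{Lin}_{\mathbb C}(V,V)$ such that $\operatorname{tr}h=0$ and $h^*=h$ for all $h\in W$, $W$ is the $\mathbb R$-span of $D_W:=\{h\in W\mid\det h=0\}$, and there is $p\in\mathbb B$ with $\langle hp,p\rangle=0$ for all $h\in W$. Every $0\ne h\in D_W$ has rank 2; its focus is $\mathbb P_{\mathbb C}\ker h$. $E_W\subset\mathbb P_{\mathbb R}W$ is given by $\det=0$. The family is elliptic if $\dim_{\mathbb R}W=3$ and $D_W\ne W$; then $E_W$ is a real plane cubic, and $\hat E_W\subset\mathbb P_{\mathbb C}(\mathbb CW)$, $\mathbb CW=W+iW$, is the corresponding complex plane cubic. An elliptic family $W$ is generic if $E_W$ contains no confocal line (a real projective line $\mathbb P_{\mathbb R}L\subset E_W$ with $\dim_{\mathbb R}L=2$ and $Lf_0=0$ for some $0\ne f_0\in V$) and $E_W$ is not a real projective line plus a point. For a generic elliptic family, all points of $\hat E_W$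 have rank 2 and $h\mapsto\mathbb P_{\mathbb C}\ker h$ is an isomorphism $\hat f$ of $\hat E_W$ onto a complex plane cubic $E\subset\mathbb P_{\mathbb C}V$. An elliptic family $W$ is real if it is generic and there are 3 distinct points in $E_W$ whose foci lie on a same complex projective line not included in $E$. Equitant families: let $p_1,\dots,p_4\in\mathbb P_{\mathbb C}V$ be points of a same signature $\sigma\in\{+1,-1,0\}$ (the sign of $\langle p_i,p_i\rangle$), no 3 of them on a same complex projective line. Choose representatives $p_i\in V$ with $\langle p_i,p_i\rangle=\sigma$ and suppose that there is $p\in V$ with $\langle p,p\rangle<0$ and $|\langle p,p_i\rangle|=1$ for all $i$. Put $w_i:=\langle-,p_i\rangle p_i$. Then $W:=\{\sum_{i=1}^4r_iw_i\mid r_i\in\mathbb R,\ \sum_{i=1}^4r_i=0\}$ is an elliptic family of bisectors, called equitant from the $p_i$'s. An elliptic family is equitant if it arises in this way. *)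

theory Defs
  imports "HOL-Analysis.Analysis"
begin

text \<open>
  The space \<open>V\<close> is \<open>complex^3\<close> with an arbitrary hermitian form of signature \<open>++-\<close>;
  linear endomorphisms of \<open>V\<close> are matrices acting by \<open>*v\<close>. The constants \<open>span\<close>, \<open>subspace\<close>,
  \<open>dim\<close> are those of real vector spaces (also on matrices), whereas \<open>vec.subspace\<close> and \<open>vec.dim\<close>
  refer to the complex structure of \<open>V\<close>.
\<close>

type_synonym cvec = "complex^3"
type_synonym cmat = "complex^3^3"

definition hermitian_form :: "(cvec \<Rightarrow> cvec \<Rightarrow> complex) \<Rightarrow> bool" where
  "hermitian_form B \<longleftrightarrow>
     (\<forall>y. Vector_Spaces.linear (*s) (*) (\<lambda>x. B x y)) \<and> (\<forall>x y. B y x = cnj (B x y))"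

text \<open>Values \<open>B x x\<close> of a hermitian form are real, so their sign is that of \<open>Re (B x x)\<close>.\<close>

definition signature_ppm :: "(cvec \<Rightarrow> cvec \<Rightarrow> complex) \<Rightarrow> bool" where
  "signature_ppm B \<longleftrightarrow>
     (\<exists>e1 e2 e3. B e1 e2 = 0 \<and> B e1 e3 = 0 \<and> B e2 e3 = 0 \<and>
        Re (B e1 e1) > 0 \<and> Re (B e2 e2) > 0 \<and> Re (B e3 e3) < 0)"

definition is_adjoint :: "(cvec \<Rightarrow> cvec \<Rightarrow> complex) \<Rightarrow> cmat \<Rightarrow> cmat \<Rightarrow> bool" where
  "is_adjoint B h k \<longleftrightarrow> (\<forall>x y. B (h *v x) y = B x (k *v y))"

definition cscale :: "complex \<Rightarrow> cmat \<Rightarrow> cmat" where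
  "cscale c h = map_matrix (\<lambda>z. c * z) h"

text \<open>
  Points of a projective space are represented by the one-dimensional subspaces
  \<open>{c v | c}\<close>, \<open>v \<noteq> 0\<close>; the parameter is the scalar multiplication in question.
\<close>

definition proj_space :: "('k \<Rightarrow> 'v \<Rightarrow> 'v) \<Rightarrow> 'v set \<Rightarrow> ('v::zero) set set" where
  "proj_space smul S = {range (\<lambda>c. smul c v) | v. v \<in> S \<and> v \<noteq> 0}"

abbreviation PC :: "cvec set \<Rightarrow> cvec set set" where
  "PC \<equiv> proj_space (*s)"

abbreviation PR_mat :: "cmat set \<Rightarrow> cmat set set" where
  "PR_mat \<equiv> proj_space scaleR"

abbreviation PC_mat :: "cmat set \<Rightarrow> cmat set set" where
  "PC_mat \<equiv> proj_space cscale"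

definition D_set :: "cmat set \<Rightarrow> cmat set" where
  "D_set W = {h \<in> W. det h = 0}"

definition bisector_family :: "(cvec \<Rightarrow> cvec \<Rightarrow> complex) \<Rightarrow> cmat set \<Rightarrow> bool" where
  "bisector_family B W \<longleftrightarrow>
     subspace W \<and> (\<forall>h\<in>W. trace h = 0 \<and> is_adjoint B h h) \<and> W = span (D_set W) \<and>
     (\<exists>p. Re (B p p) < 0 \<and> (\<forall>h\<in>W. B (h *v p) p = 0))"

definition elliptic :: "(cvec \<Rightarrow> cvec \<Rightarrow> complex) \<Rightarrow> cmat set \<Rightarrow> bool" where
  "elliptic B W \<longleftrightarrow> bisector_family B W \<and> dim W = 3 \<and> D_set W \<noteq> W"

definition E_cubic :: "cmat set \<Rightarrow> cmat set set" where
  "E_cubic W = {a \<in> PR_mat W. \<forall>h\<in>a. det h = 0}"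

definition complexification :: "cmat set \<Rightarrow> cmat set" where
  "complexification W = {h + cscale \<i> k | h k. h \<in> W \<and> k \<in> W}"

definition E_hat :: "cmat set \<Rightarrow> cmat set set" where
  "E_hat W = {a \<in> PC_mat (complexification W). \<forall>h\<in>a. det h = 0}"

text \<open>
  The common kernel of the multiples of \<open>h\<close> is \<open>ker h\<close>, for a real or complex projective point;
  it is a point of \<open>PC UNIV\<close> as soon as \<open>h\<close> has rank 2.
\<close>

definition focus :: "cmat set \<Rightarrow> cvec set" where
  "focus a = {v. \<forall>h\<in>a. h *v v = 0}"

definition focal_cubic :: "cmat set \<Rightarrow> cvec set set" where
  "focal_cubic W = focus ` E_hat W"

definition has_confocal_line :: "cmat set \<Rightarrow> bool" where
  "has_confocal_line W \<longleftrightarrow>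
     (\<exists>L f0. subspace L \<and> dim L = 2 \<and> PR_mat L \<subseteq> E_cubic W \<and> f0 \<noteq> 0 \<and> (\<forall>h\<in>L. h *v f0 = 0))"

definition is_line_plus_point :: "cmat set \<Rightarrow> bool" where
  "is_line_plus_point W \<longleftrightarrow>
     (\<exists>L a. subspace L \<and> dim L = 2 \<and> L \<subseteq> W \<and> a \<in> PR_mat W \<and> a \<notin> PR_mat L \<and>
        E_cubic W = insert a (PR_mat L))"

definition generic :: "(cvec \<Rightarrow> cvec \<Rightarrow> complex) \<Rightarrow> cmat set \<Rightarrow> bool" where
  "generic B W \<longleftrightarrow> elliptic B W \<and> \<not> has_confocal_line W \<and> \<not> is_line_plus_point W"

definition real_family :: "(cvec \<Rightarrow> cvec \<Rightarrow> complex) \<Rightarrow> cmat set \<Rightarrow> bool" where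
  "real_family B W \<longleftrightarrow> generic B W \<and>
     (\<exists>a1\<in>E_cubic W. \<exists>a2\<in>E_cubic W. \<exists>a3\<in>E_cubic W. a1 \<noteq> a2 \<and> a1 \<noteq> a3 \<and> a2 \<noteq> a3 \<and>
        (\<exists>L. vec.subspace L \<and> vec.dim L = 2 \<and>
           focus a1 \<in> PC L \<and> focus a2 \<in> PC L \<and> focus a3 \<in> PC L \<and>
           \<not> PC L \<subseteq> focal_cubic W))"

text \<open>The matrix of the map \<open>x \<mapsto> B x v w\<close>.\<close>

definition rank_one :: "(cvec \<Rightarrow> cvec \<Rightarrow> complex) \<Rightarrow> cvec \<Rightarrow> cvec \<Rightarrow> cmat" where
  "rank_one B v w = matrix (\<lambda>x. B x v *s w)"

text \<open>
  The vectors \<open>q i\<close> are the normalised representatives of four points of the projective plane;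
  \<open>4\<close> is the four-element index type.
\<close>

definition equitant_from ::
    "(cvec \<Rightarrow> cvec \<Rightarrow> complex) \<Rightarrow> (4 \<Rightarrow> cvec) \<Rightarrow> cmat set \<Rightarrow> bool" where
  "equitant_from B q W \<longleftrightarrow>
     (\<exists>\<sigma>::real. \<sigma> \<in> {1, -1, 0} \<and> (\<forall>i. q i \<noteq> 0 \<and> B (q i) (q i) = of_real \<sigma>)) \<and>
     (\<forall>i j k. i \<noteq> j \<and> i \<noteq> k \<and> j \<noteq> k \<longrightarrow>
        \<not> (\<exists>L. vec.subspace L \<and> vec.dim L = 2 \<and> q i \<in> L \<and> q j \<in> L \<and> q k \<in> L)) \<and>
     (\<exists>p. Re (B p p) < 0 \<and> (\<forall>i. cmod (B p (q i)) = 1)) \<and>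
     W = {\<Sum>i\<in>UNIV. r i *\<^sub>R rank_one B (q i) (q i) | r :: 4 \<Rightarrow> real. (\<Sum>i\<in>UNIV. r i) = 0}"

definition equitant :: "(cvec \<Rightarrow> cvec \<Rightarrow> complex) \<Rightarrow> cmat set \<Rightarrow> bool" where
  "equitant B W \<longleftrightarrow> (\<exists>q. equitant_from B q W)"

end

theory Submission
  imports Defs
begin

text \<open>
  If \<open>W\<close> is equitant from \<open>q\<^sub>1, \<dots>, q\<^sub>4\<close>, with \<open>w\<^sub>i = \<langle>-, q\<^sub>i\<rangle> q\<^sub>i\<close>, then the points \<open>w\<^sub>1 - w\<^sub>j\<close>, \<open>j \<noteq> 1\<close>, of
  \<open>E\<^sub>W\<close> have foci on the polar line of \<open>q\<^sub>1\<close>; that this line is not in \<open>E\<close>, and genericity, follow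
  since a linear relation between the \<open>q\<^sub>i\<close> with a vanishing coefficient is trivial.

  Conversely, let \<open>h\<^sub>1, h\<^sub>2, h\<^sub>3\<close> have foci \<open>f\<^sub>1 + f\<^sub>2 + f\<^sub>3 = 0\<close> on a line with polar point \<open>q\<close>. A point of the
  line outside \<open>E\<close> forces \<open>h\<^sub>1, h\<^sub>2, h\<^sub>3\<close> to be a basis of \<open>W\<close> and \<open>v\<^sub>1 = h\<^sub>1 f\<^sub>2\<close>, \<open>v\<^sub>2 = h\<^sub>2 f\<^sub>3\<close>,
  \<open>v\<^sub>3 = h\<^sub>3 f\<^sub>1\<close> to be a basis of \<open>V\<close>. If no \<open>v\<^sub>i\<close> is proportional to \<open>q\<close>, then \<open>h\<^sub>i\<close> is a combination of
  \<open>\<langle>-, v\<^sub>i\<rangle> v\<^sub>i\<close> and \<open>\<langle>-, q\<rangle> q\<close>, and \<open>W\<close> is equitant from multiples of \<open>v\<^sub>1, v\<^sub>2, v\<^sub>3, q\<close>. At most one \<open>v\<^sub>i\<close> is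
  proportional to \<open>q\<close>; in that limiting case two of the four points collide at \<open>q\<close>, and \<open>W\<close> is equitant
  from four explicit points obtained by separating them.
\<close>

section \<open>Linear algebra\<close>

context vector_space
begin

lemma span_pair_iff: "x \<in> span {a, b} \<longleftrightarrow> (\<exists>k l. x = scale k a + scale l b)"
  by (auto simp: span_breakdown_eq[of x a "{b}"] span_singleton image_iff diff_eq_eq add.commute)

lemma span_triple_iff: "x \<in> span {a, b, c} \<longleftrightarrow> (\<exists>k l m. x = scale k a + scale l b + scale m c)"
  by (simp add: span_breakdown_eq[of x a "{b, c}"] span_pair_iff diff_eq_eq ac_simps)

lemma independent_pairI:
  assumes "\<And>k l. scale k a + scale l b = 0 \<Longrightarrow> k = 0 \<and> l = 0"
  shows "independent {a, b}" and "card {a, b} = 2"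
proof -
  have b: "b \<noteq> 0" using assms[of 0 1] by auto
  have a: "a \<notin> span {b}"
    using assms[of 1 "- _"] by (auto simp: span_singleton)
  then have "a \<noteq> b" by (auto simp: span_base)
  then show "card {a, b} = 2" by simp
  show "independent {a, b}"
    using a b by (intro independent_insertI) (auto simp: independent_empty)
qed

lemma independent_tripleI:
  assumes "\<And>k l m. scale k a + scale l b + scale m c = 0 \<Longrightarrow> k = 0 \<and> l = 0 \<and> m = 0"
  shows "independent {a, b, c}" and "card {a, b, c} = 3"
proof -
  have bc: "independent {b, c}" "card {b, c} = 2"
    using assms[of 0] by (auto intro!: independent_pairI)
  have a: "a \<notin> span {b, c}"
  proof
    assume "a \<in> span {b, c}"
    then obtain k l where "a = scale k b + scale l c" by (auto simp: span_pair_iff)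
    then show False using assms[of "-1" k l] by simp
  qed
  then have "a \<notin> {b, c}" using span_base by blast
  then show "card {a, b, c} = 3" using bc(2) by simp
  show "independent {a, b, c}"
    by (rule independent_insertI[OF a bc(1)])
qed

lemma dependent_pair:
  assumes "a \<noteq> b" "k \<noteq> 0 \<or> l \<noteq> 0" "scale k a + scale l b = 0"
  shows "dependent {a, b}"
proof (rule ccontr)
  assume i: "\<not> dependent {a, b}"
  have "(\<Sum>v\<in>{a, b}. scale (if v = a then k else l) v) = 0"
    using assms(1,3) by simp
  then have "\<forall>v\<in>{a, b}. (if v = a then k else l) = 0"
    using independentD[OF i, of "{a, b}" "\<lambda>v. if v = a then k else l"] by blast
  then show False using assms(1,2) by auto
qed

end

text \<open>Stated by coefficients of an ordered triple rather than by a set, so that a repeated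
  vector counts as dependence.\<close>

definition indep3 :: "cvec \<Rightarrow> cvec \<Rightarrow> cvec \<Rightarrow> bool" where
  "indep3 u v w \<longleftrightarrow> (\<forall>a b c. a *s u + b *s v + c *s w = 0 \<longrightarrow> a = 0 \<and> b = 0 \<and> c = 0)"

lemma indep3_rotate:
  assumes "indep3 u v w"
  shows "indep3 v w u"
  unfolding indep3_def
proof (intro allI impI)
  fix a b c assume "a *s v + b *s w + c *s u = 0"
  then have "c *s u + a *s v + b *s w = 0" by (simp add: add_ac)
  then show "a = 0 \<and> b = 0 \<and> c = 0" using assms unfolding indep3_def by blast
qed

lemma injective_imp_surjective:
  fixes F :: "cvec \<Rightarrow> cvec"
  assumes "Vector_Spaces.linear (*s) (*s) F" "\<And>x. F x = 0 \<Longrightarrow> x = 0"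
  shows "\<exists>x. F x = y"
  using vec.linear_inj_imp_surj[OF assms(1)] vec.linear_inj_iff_eq_0[OF assms(1)] assms(2)
  by (metis surjD)

lemma surjective_imp_injective:
  fixes F :: "cvec \<Rightarrow> cvec"
  assumes l: "Vector_Spaces.linear (*s) (*s) F" and n: "\<nexists>x. F x = y"
  shows "\<exists>x. x \<noteq> 0 \<and> F x = 0"
  using injective_imp_surjective[OF l] n by blast

lemma linear_vecI:
  fixes F :: "cvec \<Rightarrow> cvec"
  assumes "\<And>x y. F (x + y) = F x + F y" "\<And>c x. F (c *s x) = c *s F x"
  shows "Vector_Spaces.linear (*s) (*s) F"
  unfolding Vector_Spaces.linear_iff using assms vec.vector_space_axioms by blast

lemma linear_combination3:
  "Vector_Spaces.linear (*s) (*s) (\<lambda>x::cvec. x $ 1 *s u + x $ 2 *s v + x $ 3 *s (w::cvec))"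
  by (rule linear_vecI) (simp_all add: vec.scale_left_distrib vec.scale_right_distrib)

text \<open>Independence makes the coordinate map, an endomorphism of a 3-dimensional space,
  injective and hence surjective.\<close>

lemma indep3_span:
  assumes "indep3 u v w"
  obtains a b c where "x = a *s u + b *s v + c *s w"
proof -
  have "\<exists>y::cvec. y $ 1 *s u + y $ 2 *s v + y $ 3 *s w = x"
  proof (rule injective_imp_surjective[OF linear_combination3])
    fix y :: cvec assume "y $ 1 *s u + y $ 2 *s v + y $ 3 *s w = 0"
    then have "y $ 1 = 0 \<and> y $ 2 = 0 \<and> y $ 3 = 0" by (rule assms[unfolded indep3_def, rule_format])
    then show "y = 0" by (simp add: vec_eq_iff forall_3)
  qed
  then show ?thesis by (elim exE) (rule that, rule sym)
qed

lemma spanning_imp_indep3: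
  assumes r: "\<And>x. \<exists>a b c. x = a *s u + b *s v + c *s w"
  shows "indep3 u v w"
proof -
  let ?F = "\<lambda>x::cvec. x $ 1 *s u + x $ 2 *s v + x $ 3 *s w"
  have "\<exists>x. y = ?F x" for y
  proof -
    obtain a b c where "y = a *s u + b *s v + c *s w" using r[of y] by (elim exE)
    then have "y = ?F (vector [a, b, c])" by simp
    then show ?thesis by (rule exI)
  qed
  then have "surj ?F" unfolding surj_def by (intro allI)
  then have "inj ?F" by (rule vec.linear_surj_imp_inj[OF linear_combination3])
  then have z: "\<forall>x. ?F x = 0 \<longrightarrow> x = 0"
    unfolding vec.linear_inj_iff_eq_0[OF linear_combination3] .
  show "indep3 u v w" unfolding indep3_def
  proof (intro allI impI)
    fix a b c assume "a *s u + b *s v + c *s w = 0"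
    then have "?F (vector [a, b, c]) = 0" by simp
    then have "(vector [a, b, c] :: cvec) = 0" using z by (elim allE impE)
    then show "a = 0 \<and> b = 0 \<and> c = 0"
      by (simp add: vec_eq_iff forall_3)
  qed
qed

text \<open>A coordinate map whose third column is zero kills the third basis vector, so it cannot
  be onto; any vector outside its image completes the pair.\<close>

lemma extend_pair:
  assumes "\<And>a b. a *s u + b *s v = 0 \<Longrightarrow> a = 0 \<and> b = 0"
  obtains w where "indep3 u v w"
proof -
  let ?F = "\<lambda>x::cvec. x $ 1 *s u + x $ 2 *s v + x $ 3 *s 0"
  have "\<exists>w. \<nexists>x. ?F x = w"
  proof (rule ccontr)
    assume "\<nexists>w. \<nexists>x. ?F x = w"
    then have "surj ?F" unfolding surj_def by metis
    then have "inj ?F" by (rule vec.linear_surj_imp_inj[OF linear_combination3])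
    then have "\<forall>x. ?F x = 0 \<longrightarrow> x = 0"
      unfolding vec.linear_inj_iff_eq_0[OF linear_combination3] .
    from this[rule_format, of "vector [0, 0, 1]"] show False
      by (simp add: vec_eq_iff forall_3)
  qed
  then obtain w where w: "\<And>x. ?F x \<noteq> w" by auto
  have "indep3 u v w" unfolding indep3_def
  proof (intro allI impI)
    fix a b c assume e: "a *s u + b *s v + c *s w = 0"
    have "c = 0"
    proof (rule ccontr)
      assume c: "c \<noteq> 0"
      have "w = (1/c) *s (c *s w)" using c by simp
      also have "c *s w = (- a) *s u + (- b) *s v"
        using e by (simp add: eq_neg_iff_add_eq_0 algebra_simps)
      finally have "w = (-a/c) *s u + (-b/c) *s v"
        by (simp add: vec.scale_right_distrib)
      then show False using w[of "vector [-a/c, -b/c, 0]"] by simp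
    qed
    then show "a = 0 \<and> b = 0 \<and> c = 0" using e assms by simp
  qed
  then show ?thesis by (rule that)
qed

lemma independent_pair_if_not_multiple:
  assumes "f \<noteq> (0::cvec)" "\<And>c. g \<noteq> c *s f" and e: "a *s f + b *s g = 0"
  shows "a = 0 \<and> b = 0"
proof -
  have "b = 0"
  proof (rule ccontr)
    assume "b \<noteq> 0"
    then have "g = (1 / b) *s (b *s g)" by simp
    also have "b *s g = (- a) *s f" using e by (simp add: eq_neg_iff_add_eq_0 add.commute)
    finally have "g = (- a / b) *s f" by simp
    then show False using assms(2) by blast
  qed
  then show ?thesis using e assms(1) by simp
qed

lemma extend_single:
  assumes "u \<noteq> (0::cvec)"
  obtains v w where "indep3 u v w"
proof -
  have "\<exists>v. \<forall>a. v \<noteq> a *s u"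
  proof (rule ccontr)
    assume "\<not> ?thesis"
    then have "\<exists>a. v = a *s u" for v by simp
    then have "\<exists>a b c. v = a *s u + b *s 0 + c *s 0" for v
      unfolding vec.scale_zero_right add_0_right by simp
    then have "indep3 u 0 0" by (rule spanning_imp_indep3)
    then have "0 *s u + 1 *s 0 + 0 *s 0 = (0::cvec) \<longrightarrow> (0::complex) = 0 \<and> (1::complex) = 0 \<and> (0::complex) = 0"
      unfolding indep3_def by (elim allE)
    then show False by simp
  qed
  then obtain v where v: "\<forall>a. v \<noteq> a *s u" by (elim exE)
  have ab: "a = 0 \<and> b = 0" if "a *s u + b *s v = 0" for a b
    by (rule independent_pair_if_not_multiple[OF assms v[rule_format] that])
  show ?thesis by (rule extend_pair[OF ab that])
qed

section \<open>Matrices acting on vectors\<close>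

lemma cscale_mult_vec: "cscale c h *v x = c *s (h *v x)"
  by (simp add: cscale_def map_matrix_def matrix_vector_mult_def vec_eq_iff sum_distrib_left mult.assoc)

lemma scaleR_mult_vec: "(r *\<^sub>R h) *v x = complex_of_real r *s ((h::cmat) *v x)"
  unfolding vec_eq_iff matrix_vector_mult_def
  by (simp add: sum_distrib_left scaleR_conv_of_real[where 'a=complex] mult.assoc)

lemma cmat_eqI: "(\<And>x. h *v x = k *v x) \<Longrightarrow> h = (k::cmat)"
  by (simp add: matrix_eq)

lemma det_eq_0I:
  assumes "h *v x = 0" "x \<noteq> 0"
  shows "det (h::cmat) = 0"
proof (rule ccontr)
  assume "det h \<noteq> 0"
  then obtain k where "k ** h = mat 1"
    using invertible_det_nz[of h] unfolding invertible_def by blast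
  then have "x = k *v (h *v x)" by (simp add: matrix_vector_mul_assoc)
  then show False using assms by (simp add: matrix_vector_mult_0_right)
qed

section \<open>Forms of signature ++-\<close>

locale indefinite_form =
  fixes B :: "cvec \<Rightarrow> cvec \<Rightarrow> complex"
  assumes herm: "hermitian_form B" and sig: "signature_ppm B"
begin

lemma B_add_left: "B (x + y) z = B x z + B y z"
  and B_scale_left: "B (c *s x) z = c * B x z"
  using herm unfolding hermitian_form_def Vector_Spaces.linear_iff by blast+

lemma B_commute: "B y x = cnj (B x y)"
  using herm unfolding hermitian_form_def by blast

lemma B_add_right: "B z (x + y) = B z x + B z y"
  by (simp add: B_commute[of z] B_add_left)

lemma B_scale_right: "B z (c *s x) = cnj c * B z x"
  by (simp add: B_commute[of z] B_scale_left)

lemma B_minus_left: "B (- x) z = - B x z"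
  using B_scale_left[of "-1" x z] by simp

lemma B_minus_right: "B z (- x) = - B z x"
  using B_scale_right[of z "-1" x] by simp

lemma B_diff_left: "B (x - y) z = B x z - B y z"
  using B_add_left[of x "- y" z] by (simp add: B_minus_left)

lemma B_diff_right: "B z (x - y) = B z x - B z y"
  using B_add_right[of z x "- y"] by (simp add: B_minus_right)

lemma B_zero_left [simp]: "B 0 z = 0"
  using B_scale_left[of 0 0 z] by simp

lemma B_zero_right [simp]: "B z 0 = 0"
  using B_scale_right[of z 0 0] by simp

lemmas B_simps = B_add_left B_scale_left B_add_right B_scale_right
  B_minus_left B_minus_right B_diff_left B_diff_right

lemma B_eq_0_commute: "B x y = 0 \<longleftrightarrow> B y x = 0"
  using B_commute[of x y] by simp

lemma B_self_real: "B x x = of_real (Re (B x x))"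
  using B_commute[of x x] by (simp add: complex_eq_iff)

lemma mult_B_commute: "B x y * B y x = of_real ((cmod (B x y))\<^sup>2)"
  unfolding complex_norm_square B_commute[of y x] ..

lemma orthogonal_basis:
  obtains e1 e2 e3 where "B e1 e2 = 0" "B e1 e3 = 0" "B e2 e3 = 0"
    "Re (B e1 e1) > 0" "Re (B e2 e2) > 0" "Re (B e3 e3) < 0" "indep3 e1 e2 e3"
proof -
  obtain e1 e2 e3 where e: "B e1 e2 = 0" "B e1 e3 = 0" "B e2 e3 = 0"
    "Re (B e1 e1) > 0" "Re (B e2 e2) > 0" "Re (B e3 e3) < 0"
    using sig unfolding signature_ppm_def by (elim exE conjE)
  have e': "B e2 e1 = 0" "B e3 e1 = 0" "B e3 e2 = 0"
    using e(1-3) B_eq_0_commute by blast+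
  have "indep3 e1 e2 e3" unfolding indep3_def
  proof (intro allI impI)
    fix a b c assume s: "a *s e1 + b *s e2 + c *s e3 = 0"
    have "a * B e1 e1 = 0"
      using arg_cong[OF s, of "\<lambda>x. B x e1"] e e' by (simp add: B_simps)
    moreover have "b * B e2 e2 = 0"
      using arg_cong[OF s, of "\<lambda>x. B x e2"] e e' by (simp add: B_simps)
    moreover have "c * B e3 e3 = 0"
      using arg_cong[OF s, of "\<lambda>x. B x e3"] e e' by (simp add: B_simps)
    ultimately show "a = 0 \<and> b = 0 \<and> c = 0" using e(4-6) by auto
  qed
  with e show ?thesis by (rule that)
qed

lemma nondegenerate:
  assumes "\<And>x. B x y = 0"
  shows "y = 0"
proof -
  obtain e1 e2 e3 where e: "B e1 e2 = 0" "B e1 e3 = 0" "B e2 e3 = 0"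
    "Re (B e1 e1) > 0" "Re (B e2 e2) > 0" "Re (B e3 e3) < 0" "indep3 e1 e2 e3"
    by (rule orthogonal_basis)
  obtain a b c where y: "y = a *s e1 + b *s e2 + c *s e3" using e(7) by (rule indep3_span)
  have "B e1 y = 0" "B e2 y = 0" "B e3 y = 0" using assms by simp_all
  moreover have "B e2 e1 = 0" "B e3 e1 = 0" "B e3 e2 = 0"
    using e(1-3) B_eq_0_commute by blast+
  ultimately have "a = 0 \<and> b = 0 \<and> c = 0"
    using e(1-6) unfolding y by (auto simp: B_simps)
  then show ?thesis using y by simp
qed

lemma nondegenerate_left: "(\<And>x. B y x = 0) \<Longrightarrow> y = 0"
  using nondegenerate B_eq_0_commute by blast

lemma indep3_orthogonal:
  assumes "indep3 u v w" "B y u = 0" "B y v = 0" "B y w = 0"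
  shows "y = 0"
proof (rule nondegenerate_left)
  fix x
  obtain a b c where "x = a *s u + b *s v + c *s w" using assms(1) by (rule indep3_span)
  then show "B y x = 0" using assms by (simp add: B_simps)
qed

lemma eq_if_B_eq_on_basis:
  assumes "indep3 u v w" "B y u = B z u" "B y v = B z v" "B y w = B z w"
  shows "y = z"
  using indep3_orthogonal[OF assms(1), of "y - z"] assms by (simp add: B_simps)

lemma linear_B_triple: "Vector_Spaces.linear (*s) (*s) (\<lambda>x. vector [B x u, B x v, B x w] :: cvec)"
  by (rule linear_vecI) (simp_all add: B_simps vec_eq_iff forall_3)

text \<open>Pairing with an independent triple is injective by nondegeneracy, so it attains every
  triple of values.\<close>

lemma dual_vector:
  assumes "indep3 u v w"
  obtains g where "B g u = a" "B g v = b" "B g w = c"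
proof -
  have "\<exists>g. (vector [B g u, B g v, B g w] :: cvec) = vector [a, b, c]"
    by (rule injective_imp_surjective[OF linear_B_triple])
      (rule indep3_orthogonal[OF assms], simp_all add: vec_eq_iff forall_3)
  then obtain g where "(vector [B g u, B g v, B g w] :: cvec) = vector [a, b, c]"
    by (elim exE)
  then show ?thesis by (intro that[of g]) (simp_all add: vec_eq_iff forall_3)
qed

text \<open>A relation among the three vectors restricts their pairings, so the pairing map is not
  onto and has a kernel vector.\<close>

lemma dependent_orthogonal:
  assumes "\<not> indep3 u v w"
  obtains g where "g \<noteq> 0" "B g u = 0" "B g v = 0" "B g w = 0"
proof -
  obtain a b c where s: "a *s u + b *s v + c *s w = 0" and n: "\<not> (a = 0 \<and> b = 0 \<and> c = 0)"
    using assms unfolding indep3_def by blast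
  \<comment> \<open>The coefficient triple itself is missed: pairing \<open>g\<close> with the
    relation would give |a|^2 + |b|^2 + |c|^2 = 0.\<close>
  have "(vector [B g u, B g v, B g w] :: cvec) \<noteq> vector [a, b, c]" for g
  proof
    assume "(vector [B g u, B g v, B g w] :: cvec) = vector [a, b, c]"
    then have g: "B g u = a" "B g v = b" "B g w = c"
      by (simp_all add: vec_eq_iff forall_3)
    have "B g (a *s u + b *s v + c *s w) = 0" using s by simp
    then have "cnj a * a + cnj b * b + cnj c * c = 0"
      by (simp add: B_simps g)
    then have "Re (cnj a * a + cnj b * b + cnj c * c) = 0" by simp
    then have "(cmod a)\<^sup>2 + (cmod b)\<^sup>2 + (cmod c)\<^sup>2 = 0"
      by (simp add: cmod_power2) (simp add: power2_eq_square)
    then show False using n by (simp add: add_nonneg_eq_0_iff)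
  qed
  then have "\<nexists>g. (vector [B g u, B g v, B g w] :: cvec) = vector [a, b, c]" by simp
  from surjective_imp_injective[OF linear_B_triple this]
  obtain g where "g \<noteq> 0" "(vector [B g u, B g v, B g w] :: cvec) = 0" by blast
  then show ?thesis by (intro that[of g]) (simp_all add: vec_eq_iff forall_3)
qed

lemma exists_orthogonal:
  obtains q where "q \<noteq> 0" "B q u = 0" "B q v = 0"
proof -
  have "\<not> indep3 u v 0" unfolding indep3_def
  proof
    assume "\<forall>a b c. a *s u + b *s v + c *s 0 = 0 \<longrightarrow> a = 0 \<and> b = 0 \<and> c = 0"
    then have "0 *s u + 0 *s v + 1 *s 0 = (0::cvec) \<longrightarrow> (0::complex) = 0 \<and> (0::complex) = 0 \<and> (1::complex) = 0"
      by (elim allE)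
    then show False by simp
  qed
  then show ?thesis by (rule dependent_orthogonal) (rule that)
qed

lemma orthogonal_unique:
  assumes ind: "\<And>a b. a *s u + b *s v = 0 \<Longrightarrow> a = 0 \<and> b = 0"
    and q: "q \<noteq> 0" "B q u = 0" "B q v = 0" and y: "B y u = 0" "B y v = 0"
  obtains c where "y = c *s q"
proof -
  obtain w where w: "indep3 u v w" using extend_pair[OF ind] .
  have "B q w \<noteq> 0" using indep3_orthogonal[OF w] q by blast
  then have "y = (B y w / B q w) *s q"
    by (intro eq_if_B_eq_on_basis[OF w]) (simp_all add: B_simps q y)
  then show ?thesis by (rule that)
qed

lemma orthogonal_complement:
  assumes "g \<noteq> 0"
  shows "vec.subspace {x. B x g = 0}" "vec.dim {x. B x g = 0} = 2"
proof -
  let ?L = "{x. B x g = 0}"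
  show "vec.subspace ?L"
    unfolding vec.subspace_def by (simp add: B_simps)
  obtain v w where i: "indep3 g v w" using assms by (rule extend_single)
  obtain f1 where f1: "B f1 g = 0" "B f1 v = 1" "B f1 w = 0" by (rule dual_vector[OF i])
  obtain f2 where f2: "B f2 g = 0" "B f2 v = 0" "B f2 w = 1" by (rule dual_vector[OF i])
  have z: "k = 0 \<and> l = 0" if "k *s f1 + l *s f2 = 0" for k l
    using arg_cong[OF that, of "\<lambda>x. B x v"] arg_cong[OF that, of "\<lambda>x. B x w"]
    by (simp add: B_simps f1 f2)
  have "?L = vec.span {f1, f2}"
  proof
    show "vec.span {f1, f2} \<subseteq> ?L"
      by (auto simp: vec.span_pair_iff B_simps f1 f2)
    show "?L \<subseteq> vec.span {f1, f2}"
    proof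
      fix x assume x: "x \<in> ?L"
      have "x = B x v *s f1 + B x w *s f2"
        using x by (intro eq_if_B_eq_on_basis[OF i]) (simp_all add: B_simps f1 f2)
      then show "x \<in> vec.span {f1, f2}" unfolding vec.span_pair_iff by blast
    qed
  qed
  then show "vec.dim ?L = 2"
    using vec.independent_pairI[of f1 f2, OF z] by (simp add: vec.dim_eq_card_independent)
qed

end

section \<open>Projections and the equitant criterion\<close>

lemma sum_matrix_vector_mult:
  "(\<Sum>i\<in>A. f i) *v x = (\<Sum>i\<in>A. f i *v (x::cvec))"
  by (induction A rule: infinite_finite_induct) (simp_all add: matrix_vector_mult_add_rdistrib)

lemma fourth_index: "\<exists>l::4. \<forall>m. m = i \<or> m = j \<or> m = k \<or> m = l" if "i \<noteq> j" "i \<noteq> k" "j \<noteq> k"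
proof -
  have "card {i, j, k} = 3" using that by simp
  then have "card (UNIV - {i, j, k}) = 1" by (simp add: card_Diff_subset)
  then obtain l where "UNIV - {i, j, k} = {l}" by (auto simp: card_1_singleton_iff)
  then show ?thesis by blast
qed

lemma third_index: "\<exists>k::4. k \<noteq> i \<and> k \<noteq> j"
proof (rule ccontr)
  assume "\<not> ?thesis"
  then have "UNIV = {i, j}" by blast
  then have "card (UNIV :: 4 set) = card {i, j}" by simp
  also have "\<dots> \<le> 2" by (simp add: card_insert_if)
  finally show False by simp
qed

section \<open>Points of the real cubic and their foci\<close>

lemma line_point_eq:
  assumes "range (\<lambda>c::real. c *\<^sub>R h) = range (\<lambda>c. c *\<^sub>R (k::cmat))"
  obtains c where "h = c *\<^sub>R k"
proof -
  have "1 *\<^sub>R h \<in> range (\<lambda>c::real. c *\<^sub>R h)" by (rule rangeI)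
  then show ?thesis unfolding assms using that by auto
qed

lemma E_cubicD:
  assumes "range (\<lambda>c::real. c *\<^sub>R h) \<in> E_cubic W" "subspace W"
  shows "h \<in> W"
proof -
  obtain k where k: "k \<in> W" "range (\<lambda>c::real. c *\<^sub>R h) = range (\<lambda>c. c *\<^sub>R k)"
    using assms(1) unfolding E_cubic_def proj_space_def by blast
  obtain c where "h = c *\<^sub>R k" using k(2) by (rule line_point_eq)
  then show ?thesis using k(1) assms(2) by (simp add: subspace_scale)
qed

lemma E_cubicI:
  assumes "h \<in> W" "h \<noteq> 0" "h *v x = 0" "x \<noteq> 0"
  shows "range (\<lambda>c::real. c *\<^sub>R h) \<in> E_cubic W"
proof -
  have "det (c *\<^sub>R h) = 0" for c :: real
    using assms by (intro det_eq_0I[of _ x]) (simp_all add: scaleR_mult_vec)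
  then show ?thesis using assms(1,2) by (auto simp: E_cubic_def proj_space_def)
qed

lemma focus_real_point: "focus (range (\<lambda>c::real. c *\<^sub>R h)) = {x. h *v x = 0}"
proof -
  have "h *v x = 0" if "\<forall>k\<in>range (\<lambda>c::real. c *\<^sub>R h). k *v x = 0" for x
    using that[rule_format, OF rangeI, of 1] by simp
  then show ?thesis by (auto simp: focus_def scaleR_mult_vec)
qed

lemma focus_complex_point: "focus (range (\<lambda>c. cscale c h)) = {x. h *v x = 0}"
proof -
  have "h *v x = 0" if "\<forall>k\<in>range (\<lambda>c. cscale c h). k *v x = 0" for x
    using that[rule_format, OF rangeI, of 1] by (simp add: cscale_mult_vec)
  then show ?thesis by (auto simp: focus_def cscale_mult_vec)
qed

context indefinite_form
begin

lemma rank_one_mult: "rank_one B v w *v x = B x v *s w"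
proof -
  have "Vector_Spaces.linear (*s) (*s) (\<lambda>x. B x v *s w)"
    by (rule linear_vecI) (simp_all add: B_simps vec.scale_left_distrib)
  then show ?thesis unfolding rank_one_def by (rule matrix_works)
qed

lemma trace_rank_one: "trace (rank_one B v w) = B w v"
proof -
  have "trace (rank_one B v w) = (\<Sum>i\<in>UNIV. w $ i * B (axis i 1) v)"
    by (simp add: trace_def rank_one_def matrix_def mult.commute)
  also have "\<dots> = B (w $ 1 *s axis 1 1 + w $ 2 *s axis 2 1 + w $ 3 *s axis 3 1) v"
    by (simp add: sum_3 B_simps)
  also have "w $ 1 *s axis 1 1 + w $ 2 *s axis 2 1 + w $ 3 *s axis 3 1 = w"
    using basis_expansion[of w] by (simp add: sum_3)
  finally show ?thesis .
qed

text \<open>The differences lie in \<open>W\<close>, so their zero traces make all self-pairings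
  equal, and the condition at \<open>p\<close> makes all pairings with \<open>p\<close> equal in
  modulus. A common real rescaling normalises the four vectors, and a rescaling of \<open>p\<close>
  gives modulus 1. General position is encoded by the nonzero \<open>c1\<close>, \<open>c2\<close>,
  \<open>c3\<close>.\<close>

lemma equitantI:
  assumes tr: "\<And>h. h \<in> W \<Longrightarrow> trace h = 0"
    and p: "Re (B p p) < 0" "\<And>h. h \<in> W \<Longrightarrow> B (h *v p) p = 0"
    and ind: "indep3 q1 q2 q3"
    and q4: "q4 = c1 *s q1 + c2 *s q2 + c3 *s q3" "c1 \<noteq> 0" "c2 \<noteq> 0" "c3 \<noteq> 0"
    and W: "W = span {rank_one B q1 q1 - rank_one B q4 q4, rank_one B q2 q2 - rank_one B q4 q4,
      rank_one B q3 q3 - rank_one B q4 q4}"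
  shows "equitant B W"
proof -
  define \<sigma> where "\<sigma> = Re (B q4 q4)"
  \<comment> \<open>Scaling by \<open>s\<close> multiplies self-pairings by \<open>s * s\<close>, so
    this \<open>s\<close> turns \<sigma> into its sign; for isotropic points the scale is arbitrary
    and 1 is taken.\<close>
  define s where "s = (if \<sigma> = 0 then 1 else 1 / sqrt \<bar>\<sigma>\<bar>)"
  define m where "m = cmod (B p q4)"
  define q where "q = (\<lambda>i::4. complex_of_real s *s
    (if i = 1 then q1 else if i = 2 then q2 else if i = 3 then q3 else q4))"
  have q_simps: "q 1 = of_real s *s q1" "q 2 = of_real s *s q2" "q 3 = of_real s *s q3"
    "q 4 = of_real s *s q4"
    by (simp_all add: q_def)
  have s: "s > 0" by (simp add: s_def)
  have same: "B x x = B q4 q4 \<and> cmod (B p x) = m" if "x \<in> {q1, q2, q3}" for x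
  proof -
    have x: "rank_one B x x - rank_one B q4 q4 \<in> W"
      unfolding W using that by (intro span_base) auto
    have "B x x = B q4 q4" using tr[OF x] by (simp add: trace_sub trace_rank_one)
    moreover have "B p x * B x p = B p q4 * B q4 p"
      using p(2)[OF x] by (simp add: matrix_vector_mult_diff_rdistrib rank_one_mult B_simps)
    then have "cmod (B p x) = m"
      unfolding mult_B_commute m_def by (simp flip: of_real_power)
    ultimately show ?thesis by simp
  qed
  have m: "m > 0"
  proof (rule ccontr)
    assume "\<not> m > 0"
    then have "m = 0" by (simp add: m_def)
    then have "B p q1 = 0" "B p q2 = 0" "B p q3 = 0" using same by auto
    then have "p = 0" using indep3_orthogonal[OF ind] by blast
    then show False using p(1) by simp
  qed
  have sgn: "B (q i) (q i) = of_real (sgn \<sigma>)" for i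
  proof -
    have "B (q i) (q i) = of_real s * of_real s * of_real \<sigma>"
      using same B_self_real[of q4] by (auto simp: q_def B_simps \<sigma>_def)
    also have "\<dots> = of_real (s * s * \<sigma>)" by simp
    also have "s * s * \<sigma> = sgn \<sigma>"
      by (simp add: s_def sgn_if field_simps)
    finally show ?thesis .
  qed
  have nz: "q1 \<noteq> 0" "q2 \<noteq> 0" "q3 \<noteq> 0"
    using ind[unfolded indep3_def, rule_format, of 1 0 0] ind[unfolded indep3_def, rule_format, of 0 1 0]
      ind[unfolded indep3_def, rule_format, of 0 0 1] by auto
  have nz4: "q4 \<noteq> 0" using ind[unfolded indep3_def, rule_format, of c1 c2 c3] q4 by auto
  have "q i \<noteq> 0" for i using nz nz4 s by (simp add: q_def)
  then have 1: "\<exists>\<sigma>::real. \<sigma> \<in> {1, -1, 0} \<and> (\<forall>i. q i \<noteq> 0 \<and> B (q i) (q i) = of_real \<sigma>)"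
    using sgn by (intro exI[of _ "sgn \<sigma>"]) (auto simp: sgn_if)
  \<comment> \<open>Coefficients of the relation \<open>c1 q1 + c2 q2 + c3 q3 - q4 = 0\<close>. None
    vanishes, so a plane containing three of the vectors contains the fourth as well, hence the
    whole space.\<close>
  define d where "d = (\<lambda>i::4. if i = 1 then c1 else if i = 2 then c2 else if i = 3 then c3 else -1)"
  have d: "d i \<noteq> 0" for i using q4 by (simp add: d_def)
  have "(\<Sum>i\<in>UNIV. d i *s q i) = of_real s *s (c1 *s q1 + c2 *s q2 + c3 *s q3 - q4)"
    by (simp add: sum_4 d_def q_def vec.scale_right_distrib vec.scale_right_diff_distrib mult.commute)
  then have dq: "(\<Sum>i\<in>UNIV. d i *s q i) = 0" by (simp add: q4(1))
  have 2: "\<not> (\<exists>L. vec.subspace L \<and> vec.dim L = 2 \<and> q i \<in> L \<and> q j \<in> L \<and> q k \<in> L)"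
    if ijk: "i \<noteq> j \<and> i \<noteq> k \<and> j \<noteq> k" for i j k
  proof
    assume "\<exists>L. vec.subspace L \<and> vec.dim L = 2 \<and> q i \<in> L \<and> q j \<in> L \<and> q k \<in> L"
    then obtain L where L: "vec.subspace L" "vec.dim L = 2" "q i \<in> L" "q j \<in> L" "q k \<in> L"
      by (elim exE conjE)
    obtain l where l: "\<forall>m. m = i \<or> m = j \<or> m = k \<or> m = l"
      using fourth_index ijk by blast
    then have other: "q m \<in> L" if "m \<noteq> l" for m
      using l[rule_format, of m] L(3-5) that by auto
    have "d l *s q l + (\<Sum>m\<in>UNIV - {l}. d m *s q m) = 0"
      using dq sum.remove[of UNIV l "\<lambda>m. d m *s q m"] by simp
    then have "d l *s q l = - (\<Sum>m\<in>UNIV - {l}. d m *s q m)" by (simp add: eq_neg_iff_add_eq_0)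
    moreover have "(\<Sum>m\<in>UNIV - {l}. d m *s q m) \<in> L"
      using L(1) other by (intro vec.subspace_sum vec.subspace_scale) auto
    ultimately have "d l *s q l \<in> L" using L(1) by (simp add: vec.subspace_neg)
    then have "(1 / d l) *s (d l *s q l) \<in> L" using L(1) by (rule vec.subspace_scale[rotated])
    then have "q l \<in> L" using d by simp
    then have qL: "q m \<in> L" for m using other[of m] by (cases "m = l") auto
    have sc: "x \<in> L" if "complex_of_real s *s x \<in> L" for x
      using vec.subspace_scale[OF L(1) that, of "1 / of_real s"] s by simp
    have q123: "q1 \<in> L" "q2 \<in> L" "q3 \<in> L"
      using qL[of 1] qL[of 2] qL[of 3] sc by (simp_all add: q_simps)
    have "x \<in> L" for x
    proof -
      obtain a b c where "x = a *s q1 + b *s q2 + c *s q3" using ind by (rule indep3_span)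
      then show "x \<in> L" using q123 L(1) by (simp add: vec.subspace_add vec.subspace_scale)
    qed
    then have "L = UNIV" by blast
    then have "CARD(3) = 2" using L(2) vec_dim_card[where 'a=complex and 'n=3] by metis
    then show False by simp
  qed
  define p' where "p' = complex_of_real (1 / (s * m)) *s p"
  have "B p' p' = of_real ((1 / (s * m))\<^sup>2 * Re (B p p))"
    using B_self_real[of p] by (simp add: p'_def B_simps power2_eq_square)
  then have "Re (B p' p') = (1 / (s * m))\<^sup>2 * Re (B p p)" by simp
  then have "Re (B p' p') < 0" using p(1) s m by (simp add: mult_less_0_iff)
  moreover have "cmod (B p' (q i)) = 1" for i
  proof -
    have "cmod (B p' (q i)) = (1 / (s * m)) * (s * m)"
      using same s m by (auto simp: p'_def q_def B_simps norm_mult norm_divide m_def)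
    then show ?thesis using s m by simp
  qed
  ultimately have 3: "\<exists>p. Re (B p p) < 0 \<and> (\<forall>i. cmod (B p (q i)) = 1)" by blast
  let ?P = "\<lambda>x. rank_one B x x"
  have P: "?P (of_real s *s x) = (s * s) *\<^sub>R ?P x" for x
    by (rule cmat_eqI) (simp add: rank_one_mult scaleR_mult_vec B_simps mult.commute mult.left_commute)
  have 4: "W = {\<Sum>i\<in>UNIV. r i *\<^sub>R rank_one B (q i) (q i) | r :: 4 \<Rightarrow> real. (\<Sum>i\<in>UNIV. r i) = 0}"
    (is "_ = ?R")
  proof
    show "W \<subseteq> ?R"
    proof
      fix h assume "h \<in> W"
      then obtain k l n where h: "h = k *\<^sub>R (?P q1 - ?P q4) + l *\<^sub>R (?P q2 - ?P q4) + n *\<^sub>R (?P q3 - ?P q4)"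
        unfolding W real_vector.span_triple_iff by blast
      \<comment> \<open>The factor \<open>1 / (s * s)\<close> undoes the rescaling; the fourth
        coefficient is forced by the zero sum.\<close>
      define r where "r = (\<lambda>i::4. (1 / (s * s)) * (if i = 1 then k else if i = 2 then l
        else if i = 3 then n else - (k + l + n)))"
      have "(\<Sum>i\<in>UNIV. r i) = 0"
        by (simp add: sum_4 r_def flip: add_divide_distrib)
      moreover have rs: "r 1 * (s * s) = k" "r 2 * (s * s) = l" "r 3 * (s * s) = n"
        "r 4 * (s * s) = - (k + l + n)"
        using s by (simp_all add: r_def)
      have "(\<Sum>i\<in>UNIV. r i *\<^sub>R ?P (q i)) = h"
        unfolding sum_4 q_simps P scaleR_scaleR h rs by (simp add: algebra_simps)
      ultimately show "h \<in> ?R" by blast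
    qed
    show "?R \<subseteq> W"
    proof
      fix h assume "h \<in> ?R"
      then obtain r :: "4 \<Rightarrow> real" where r: "(\<Sum>i\<in>UNIV. r i) = 0"
        and h: "h = (\<Sum>i\<in>UNIV. r i *\<^sub>R ?P (q i))" by blast
      have r4: "r 4 = - r 1 - r 2 - r 3" using r by (simp add: sum_4)
      have "h = (s * s * r 1) *\<^sub>R (?P q1 - ?P q4) + (s * s * r 2) *\<^sub>R (?P q2 - ?P q4)
        + (s * s * r 3) *\<^sub>R (?P q3 - ?P q4)"
        unfolding h sum_4 q_simps P r4 by (simp add: algebra_simps)
      then show "h \<in> W" unfolding W real_vector.span_triple_iff by blast
    qed
  qed
  have "equitant_from B q W"
    unfolding equitant_from_def using 1 2 3 4 by blast
  then show ?thesis unfolding equitant_def by blast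
qed

end

section \<open>Equitant families are real\<close>

lemma dim_2_basis:
  assumes "subspace L" "dim L = 2"
  obtains b1 b2 where "b1 \<in> L" "b2 \<in> L" "b1 \<noteq> b2" "independent {b1, b2}" "L = span {b1, b2}"
proof -
  obtain S where S: "S \<subseteq> L" "independent S" "L \<subseteq> span S" "card S = dim L"
    by (rule basis_exists)
  obtain b1 b2 where b: "S = {b1, b2}" "b1 \<noteq> b2"
    using S(4) assms(2) by (auto simp: card_2_iff)
  have "span {b1, b2} = L" using S(1,3) assms(1) unfolding b(1) by (rule span_subspace)
  then show ?thesis
    using S(1,2) b by (intro that[of b1 b2]) auto
qed

context indefinite_form
begin

section \<open>Four points in general position\<close>

context
  fixes q :: "4 \<Rightarrow> cvec" and W :: "cmat set"
  assumes W: "W = {\<Sum>i\<in>UNIV. r i *\<^sub>R rank_one B (q i) (q i) | r :: 4 \<Rightarrow> real. (\<Sum>i\<in>UNIV. r i) = 0}"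
    and gp: "\<And>i j k L. i \<noteq> j \<Longrightarrow> i \<noteq> k \<Longrightarrow> j \<noteq> k \<Longrightarrow> vec.subspace L \<Longrightarrow> vec.dim L = 2 \<Longrightarrow>
      q i \<in> L \<Longrightarrow> q j \<in> L \<Longrightarrow> q k \<in> L \<Longrightarrow> False"
begin

abbreviation proj :: "4 \<Rightarrow> cmat" where
  "proj i \<equiv> rank_one B (q i) (q i)"

lemma combination_mult:
  "(\<Sum>i\<in>UNIV. r i *\<^sub>R proj i) *v x = (\<Sum>i\<in>UNIV. (of_real (r i) * B x (q i)) *s q i)"
  by (simp add: sum_matrix_vector_mult scaleR_mult_vec rank_one_mult)

lemma orthogonal_to_three:
  assumes "i \<noteq> j" "i \<noteq> k" "j \<noteq> k" "B f (q i) = 0" "B f (q j) = 0" "B f (q k) = 0"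
  shows "f = 0"
proof (rule ccontr)
  assume f: "f \<noteq> 0"
  show False
    by (rule gp[OF assms(1-3) orthogonal_complement[OF f]])
      (use assms B_eq_0_commute in auto)
qed

lemma indep3_q:
  assumes "i \<noteq> j" "i \<noteq> k" "j \<noteq> k"
  shows "indep3 (q i) (q j) (q k)"
  using orthogonal_to_three[OF assms] dependent_orthogonal by blast

text \<open>Dropping the vanishing term leaves a relation among three of the vectors, which are
  independent. This rigidity excludes confocal lines and also yields a point of the polar line of
  \<open>q 1\<close> outside \<open>E\<close>.\<close>

lemma relation_zero:
  assumes s: "(\<Sum>i\<in>UNIV. c i *s q i) = 0" and j: "c j = 0"
  shows "c i = 0"
proof (cases "i = j")
  case False
  obtain k where k: "k \<noteq> i" "k \<noteq> j" using third_index by blast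
  obtain l where l: "\<forall>m. m = i \<or> m = j \<or> m = k \<or> m = l"
    using fourth_index[of i j k] k False by blast
  have "l \<noteq> i \<and> l \<noteq> j \<and> l \<noteq> k"
  proof -
    have "card (UNIV :: 4 set) \<le> card {i, j, k}" if "l = i \<or> l = j \<or> l = k"
      using that l by (intro card_mono) auto
    moreover have "card {i, j, k} \<le> 3" by (simp add: card_insert_if)
    ultimately show ?thesis by fastforce
  qed
  then have U: "UNIV = {j, i, k, l}" "distinct [j, i, k, l]" using l k False by auto
  have "c i *s q i + c k *s q k + c l *s q l = 0"
    using s U(2) j unfolding U(1) by (simp add: ac_simps)
  moreover have "indep3 (q i) (q k) (q l)" using U(2) by (intro indep3_q) auto
  ultimately show ?thesis unfolding indep3_def by blast
qed (use j in simp)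

lemma proj_diff_in_W: "proj i - proj j \<in> W"
proof -
  let ?r = "\<lambda>k. (if k = i then 1 else 0) - (if k = j then 1 else 0) :: real"
  have "(\<Sum>k\<in>UNIV. ?r k) = 0" by (simp add: sum_subtractf)
  moreover have "(\<Sum>k\<in>UNIV. ?r k *\<^sub>R proj k) = proj i - proj j"
    by (simp add: scaleR_diff_left sum_subtractf if_distrib[of "\<lambda>x. x *\<^sub>R _"] cong: if_cong)
  ultimately show ?thesis unfolding W by (intro CollectI exI[of _ ?r]) simp
qed

lemma proj_diff_kernel:
  assumes "i \<noteq> j"
  shows "(proj i - proj j) *v x = 0 \<longleftrightarrow> B x (q i) = 0 \<and> B x (q j) = 0"
proof
  assume e: "(proj i - proj j) *v x = 0"
  obtain k where k: "k \<noteq> i" "k \<noteq> j" using third_index by blast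
  have "indep3 (q i) (q j) (q k)" using k assms by (intro indep3_q) auto
  moreover have "B x (q i) *s q i + (- B x (q j)) *s q j + 0 *s q k = 0"
    using e by (simp add: matrix_vector_mult_diff_rdistrib rank_one_mult)
  ultimately show "B x (q i) = 0 \<and> B x (q j) = 0" unfolding indep3_def by fastforce
qed (simp add: matrix_vector_mult_diff_rdistrib rank_one_mult)

text \<open>A vector orthogonal to \<open>q i\<close> and \<open>q j\<close> but not to
  \<open>q k\<close> is killed by the right side, while the left side sends it to a nonzero multiple
  of \<open>q k\<close>.\<close>

lemma proj_diff_not_proportional:
  assumes "i \<noteq> j" "k \<noteq> i" "k \<noteq> j" "x \<in> {i, j}"
  shows "proj x - proj k \<noteq> c *\<^sub>R (proj i - proj j)"
proof
  assume e: "proj x - proj k = c *\<^sub>R (proj i - proj j)"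
  have i: "indep3 (q i) (q j) (q k)" using assms by (intro indep3_q) auto
  obtain g where g: "B g (q i) = 0" "B g (q j) = 0" "B g (q k) = 1" by (rule dual_vector[OF i])
  have "q k = 0" using arg_cong[OF e, of "\<lambda>h. h *v g"] g assms(4)
    by (auto simp: matrix_vector_mult_diff_rdistrib rank_one_mult scaleR_mult_vec)
  then show False using g by simp
qed

lemma proj_diff_nonzero: "i \<noteq> j \<Longrightarrow> proj i - proj j \<noteq> 0"
proof
  assume ij: "i \<noteq> j" and e: "proj i - proj j = 0"
  obtain k where k: "k \<noteq> i" "k \<noteq> j" using third_index by blast
  show False using proj_diff_not_proportional[of i k j i 0] k ij e by auto
qed

lemma proj_diff_in_E_cubic:
  assumes "i \<noteq> j"
  shows "range (\<lambda>c::real. c *\<^sub>R (proj i - proj j)) \<in> E_cubic W"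
proof -
  obtain x where x: "x \<noteq> 0" "B x (q i) = 0" "B x (q j) = 0" by (rule exists_orthogonal)
  show ?thesis
    using proj_diff_in_W proj_diff_nonzero[OF assms] _ x(1)
    by (rule E_cubicI) (simp add: proj_diff_kernel[OF assms] x)
qed

lemma proj_diff_points_distinct:
  assumes "i \<noteq> j" "k \<noteq> i" "k \<noteq> j" "x \<in> {i, j}"
  shows "range (\<lambda>c::real. c *\<^sub>R (proj x - proj k)) \<noteq> range (\<lambda>c. c *\<^sub>R (proj i - proj j))"
  using line_point_eq proj_diff_not_proportional[OF assms] by metis

lemma W_spanned:
  assumes "h \<in> W"
  obtains r1 r2 r3 where
    "h = r1 *\<^sub>R (proj 1 - proj 4) + r2 *\<^sub>R (proj 2 - proj 4) + r3 *\<^sub>R (proj 3 - proj 4)"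
proof -
  obtain r :: "4 \<Rightarrow> real" where r: "(\<Sum>i\<in>UNIV. r i) = 0" "h = (\<Sum>i\<in>UNIV. r i *\<^sub>R proj i)"
    using assms unfolding W by blast
  have r4: "r 4 = - r 1 - r 2 - r 3" using r(1) by (simp add: sum_4)
  have "h = r 1 *\<^sub>R (proj 1 - proj 4) + r 2 *\<^sub>R (proj 2 - proj 4) + r 3 *\<^sub>R (proj 3 - proj 4)"
    unfolding r(2) sum_4 r4 by (simp add: algebra_simps)
  then show ?thesis by (rule that)
qed

text \<open>If \<open>proj i - proj j\<close> were the extra point \<open>a\<close>, then for a
  third index \<open>k\<close> both \<open>proj i - proj k\<close> and
  \<open>proj j - proj k\<close> would lie in \<open>L\<close>, and so would their difference. Thus
  \<open>L\<close> contains all the differences, hence \<open>W\<close>, against the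
  dimensions.\<close>

lemma not_line_plus_point:
  assumes "dim W = 3"
  shows "\<not> is_line_plus_point W"
proof
  assume "is_line_plus_point W"
  then obtain L a where L: "subspace L" "dim L = 2" and E: "E_cubic W = insert a (PR_mat L)"
    unfolding is_line_plus_point_def by blast
  have inL: "h \<in> L" if "range (\<lambda>c::real. c *\<^sub>R h) \<in> PR_mat L" for h
  proof -
    have "\<exists>k\<in>L. range (\<lambda>c::real. c *\<^sub>R h) = range (\<lambda>c. c *\<^sub>R k)"
      using that unfolding proj_space_def by auto
    then obtain k where k: "k \<in> L" "range (\<lambda>c::real. c *\<^sub>R h) = range (\<lambda>c. c *\<^sub>R k)" by (elim bexE)
    obtain c where "h = c *\<^sub>R k" using k(2) by (rule line_point_eq)
    then show ?thesis using k(1) L(1) by (simp add: subspace_scale)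
  qed
  let ?pt = "\<lambda>i j. range (\<lambda>c::real. c *\<^sub>R (proj i - proj j))"
  have "proj i - proj j \<in> L" if ij: "i \<noteq> j" for i j
  proof (rule ccontr)
    assume n: "proj i - proj j \<notin> L"
    then have a: "?pt i j = a" using proj_diff_in_E_cubic[OF ij] inL E by auto
    obtain k where k: "k \<noteq> i" "k \<noteq> j" using third_index by blast
    have xk: "proj x - proj k \<in> L" if x: "x \<in> {i, j}" for x
    proof -
      have "x \<noteq> k" using x k by auto
      then show ?thesis
        using proj_diff_in_E_cubic[of x k] inL proj_diff_points_distinct[OF ij k x] a E by auto
    qed
    have "(proj i - proj k) - (proj j - proj k) \<in> L"
      using L(1) xk[of i] xk[of j] by (simp only: subspace_diff insert_iff simp_thms)
    then show False using n by simp
  qed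
  then have "proj 1 - proj 4 \<in> L" "proj 2 - proj 4 \<in> L" "proj 3 - proj 4 \<in> L" by simp_all
  then have "h \<in> L" if "h \<in> W" for h
    using W_spanned[OF that] L(1) by (metis subspace_add subspace_scale)
  then have "dim W \<le> dim L" by (intro dim_subset) auto
  then show False using assms L(2) by simp
qed

text \<open>The pencil \<open>L\<close> has a nonzero member whose coefficient at a chosen index
  \<open>j\<close> vanishes. Evaluated at \<open>f0\<close>, it becomes a relation among the
  \<open>q i\<close> with a vanishing coefficient, so every term of it is zero.\<close>

lemma no_confocal_line:
  assumes "subspace W"
  shows "\<not> has_confocal_line W"
proof
  assume "has_confocal_line W"
  then obtain L f0 where L: "subspace L" "dim L = 2" "PR_mat L \<subseteq> E_cubic W"
    and f0: "f0 \<noteq> 0" "\<And>h. h \<in> L \<Longrightarrow> h *v f0 = 0"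
    unfolding has_confocal_line_def by blast
  obtain b1 b2 where b: "b1 \<in> L" "b2 \<in> L" "b1 \<noteq> b2" "independent {b1, b2}"
    using dim_2_basis[OF L(1,2)] by metis
  have LW: "h \<in> W" if "h \<in> L" for h
  proof (cases "h = 0")
    case True then show ?thesis using assms by (simp add: subspace_0)
  next
    case False
    then have "range (\<lambda>c::real. c *\<^sub>R h) \<in> E_cubic W"
      using L(3) that unfolding proj_space_def by blast
    then show ?thesis using assms by (rule E_cubicD)
  qed
  obtain r :: "4 \<Rightarrow> real" where r: "(\<Sum>i\<in>UNIV. r i) = 0" "b1 = (\<Sum>i\<in>UNIV. r i *\<^sub>R proj i)"
    using LW[OF b(1)] unfolding W by blast
  obtain s :: "4 \<Rightarrow> real" where s: "(\<Sum>i\<in>UNIV. s i) = 0" "b2 = (\<Sum>i\<in>UNIV. s i *\<^sub>R proj i)"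
    using LW[OF b(2)] unfolding W by blast
  \<comment> \<open>If \<open>f0\<close> is orthogonal to some \<open>q i\<close>, then
    \<open>j\<close> is such an index; otherwise it is arbitrary.\<close>
  obtain j where j: "(\<forall>i. B f0 (q i) \<noteq> 0) \<or> B f0 (q j) = 0" by blast
  obtain \<alpha> \<beta> :: real where ab: "\<alpha> \<noteq> 0 \<or> \<beta> \<noteq> 0" "\<alpha> * r j + \<beta> * s j = 0"
  proof (cases "r j = 0 \<and> s j = 0")
    case True then show ?thesis using that[of 1 0] by simp
  next
    case False then show ?thesis using that[of "s j" "- r j"] by auto
  qed
  define t where "t = (\<lambda>i. \<alpha> * r i + \<beta> * s i)"
  have tj: "t j = 0" using ab(2) by (simp add: t_def)
  have t0: "(\<Sum>i\<in>UNIV. t i) = 0"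
    using r(1) s(1) by (simp add: t_def sum.distrib flip: sum_distrib_left)
  have h: "\<alpha> *\<^sub>R b1 + \<beta> *\<^sub>R b2 = (\<Sum>i\<in>UNIV. t i *\<^sub>R proj i)"
    unfolding r(2) s(2) t_def by (simp add: scaleR_sum_right sum.distrib scaleR_add_left)
  have "(\<alpha> *\<^sub>R b1 + \<beta> *\<^sub>R b2) *v f0 = 0"
    using f0(2)[OF b(1)] f0(2)[OF b(2)] by (simp add: matrix_vector_mult_add_rdistrib scaleR_mult_vec)
  then have "(\<Sum>i\<in>UNIV. (of_real (t i) * B f0 (q i)) *s q i) = 0"
    unfolding h combination_mult .
  then have "complex_of_real (t i) * B f0 (q i) = 0" for i
    by (rule relation_zero[of "\<lambda>i. of_real (t i) * B f0 (q i)" j]) (simp add: tj)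
  then have tB: "t i = 0 \<or> B f0 (q i) = 0" for i by simp
  \<comment> \<open>A nonzero \<open>t i\<close> makes \<open>f0\<close> orthogonal to
    \<open>q i\<close> and, by the choice of \<open>j\<close>, to \<open>q j\<close>. Being nonzero,
    \<open>f0\<close> is orthogonal to no third \<open>q k\<close>, so \<open>t i\<close> is the
    only nonzero coefficient, against the zero sum.\<close>
  have "t i = 0" for i
  proof (rule ccontr)
    assume ti: "t i \<noteq> 0"
    then have Bi: "B f0 (q i) = 0" "i \<noteq> j" "B f0 (q j) = 0" using tB[of i] tj j by auto
    have "t k = 0" if "k \<noteq> i" for k
    proof (cases "k = j")
      case False
      then have "B f0 (q k) \<noteq> 0" using orthogonal_to_three[of i j k f0] Bi that f0(1) by auto
      then show ?thesis using tB by blast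
    qed (use tj in simp)
    then have "(\<Sum>k\<in>UNIV. t k) = t i"
      using sum.remove[of UNIV i t] by simp
    then show False using t0 ti by simp
  qed
  then have "\<alpha> *\<^sub>R b1 + \<beta> *\<^sub>R b2 = 0" unfolding h by simp
  then show False using real_vector.dependent_pair[OF b(3) ab(1)] b(4) by blast
qed

text \<open>Take \<open>f\<close> on the polar line of \<open>q 1\<close> but off those of the other
  three points. A complex combination killing \<open>f\<close> gives a relation whose first term
  vanishes, so its other three coefficients are zero, and the zero sum disposes of the
  first.\<close>

lemma hyperplane_not_in_focal_cubic:
  assumes "q 1 \<noteq> 0"
  shows "\<not> PC {x. B x (q 1) = 0} \<subseteq> focal_cubic W"
proof
  assume sub: "PC {x. B x (q 1) = 0} \<subseteq> focal_cubic W"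
  have "\<exists>f. B f (q 1) = 0 \<and> B f (q 2) \<noteq> 0 \<and> B f (q 3) \<noteq> 0 \<and> B f (q 4) \<noteq> 0"
  proof -
    \<comment> \<open>Both candidates \<open>f\<close> and \<open>g\<close> avoid the polar lines of
      \<open>q 2\<close> and \<open>q 3\<close>. Were both orthogonal to \<open>q 4\<close>, then
      \<open>g - f\<close> would be orthogonal to \<open>q 1\<close>, \<open>q 2\<close>,
      \<open>q 4\<close> and vanish, although \<open>f\<close> and \<open>g\<close> differ in their
      pairing with \<open>q 3\<close>.\<close>
    have i: "indep3 (q 1) (q 2) (q 3)" by (rule indep3_q) simp_all
    obtain f where f: "B f (q 1) = 0" "B f (q 2) = 1" "B f (q 3) = 1" by (rule dual_vector[OF i])
    obtain g where g: "B g (q 1) = 0" "B g (q 2) = 1" "B g (q 3) = 2" by (rule dual_vector[OF i])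
    have "g - f = 0" if "B f (q 4) = 0" "B g (q 4) = 0"
      by (rule orthogonal_to_three[of 1 2 4]) (use f g that in \<open>simp_all add: B_simps\<close>)
    then have "B f (q 4) \<noteq> 0 \<or> B g (q 4) \<noteq> 0" using f(3) g(3) by auto
    then show ?thesis using f g by (metis one_neq_zero zero_neq_numeral)
  qed
  then obtain f where f: "B f (q 1) = 0" "B f (q 2) \<noteq> 0" "B f (q 3) \<noteq> 0" "B f (q 4) \<noteq> 0" by blast
  have "f \<noteq> 0" using f(2) by auto
  then have "range (\<lambda>c. c *s f) \<in> PC {x. B x (q 1) = 0}" using f(1) by (auto simp: proj_space_def)
  then obtain a where a: "a \<in> E_hat W" "range (\<lambda>c. c *s f) = focus a"
    using sub by (auto simp: focal_cubic_def)
  obtain h where h: "h \<in> complexification W" "h \<noteq> 0" "a = range (\<lambda>c. cscale c h)"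
    using a(1) unfolding E_hat_def proj_space_def by blast
  have "1 *s f \<in> range (\<lambda>c. c *s f)" by (rule rangeI)
  then have hf: "h *v f = 0" unfolding a(2) h(3) focus_complex_point by simp
  obtain h1 h2 where h12: "h = h1 + cscale \<i> h2" "h1 \<in> W" "h2 \<in> W"
    using h(1) unfolding complexification_def by blast
  obtain r :: "4 \<Rightarrow> real" where r: "(\<Sum>i\<in>UNIV. r i) = 0" "h1 = (\<Sum>i\<in>UNIV. r i *\<^sub>R proj i)"
    using h12(2) unfolding W by blast
  obtain s :: "4 \<Rightarrow> real" where s: "(\<Sum>i\<in>UNIV. s i) = 0" "h2 = (\<Sum>i\<in>UNIV. s i *\<^sub>R proj i)"
    using h12(3) unfolding W by blast
  have "h *v f = (\<Sum>i\<in>UNIV. (Complex (r i) (s i) * B f (q i)) *s q i)"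
    unfolding h12(1) r(2) s(2) matrix_vector_mult_add_rdistrib cscale_mult_vec combination_mult
      vec.scale_sum_right sum.distrib[symmetric] vec.scale_scale vec.scale_left_distrib[symmetric]
    by (intro sum.cong refl arg_cong2[of _ _ _ _ "(*s)"])
      (simp only: Complex_eq ring_distribs mult.assoc)
  then have e: "(\<Sum>i\<in>UNIV. (Complex (r i) (s i) * B f (q i)) *s q i) = 0" using hf by simp
  have z: "Complex (r i) (s i) * B f (q i) = 0" for i
    using e by (rule relation_zero[of "\<lambda>i. Complex (r i) (s i) * B f (q i)" 1]) (simp add: f)
  have "r i = 0 \<and> s i = 0" if "i \<in> {2, 3, 4}" for i
  proof -
    have "Complex (r i) (s i) = 0" using z[of i] f that by auto
    then show ?thesis by (simp add: complex_eq_iff)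
  qed
  then have rs: "r 2 = 0" "r 3 = 0" "r 4 = 0" "s 2 = 0" "s 3 = 0" "s 4 = 0" by simp_all
  then have "r 1 = 0" "s 1 = 0" using r(1) s(1) by (simp_all add: sum_4)
  then have "h1 = 0" "h2 = 0" using rs by (simp_all add: r(2) s(2) sum_4)
  then have "h = 0" using h12(1) by (simp add: cscale_def map_matrix_def vec_eq_iff)
  then show False using h(2) by simp
qed

lemma equitant_points_real:
  assumes "elliptic B W"
  shows "real_family B W"
proof -
  have sW: "subspace W" and dW: "dim W = 3"
    using assms by (auto simp: elliptic_def bisector_family_def)
  have gen: "generic B W"
    unfolding generic_def using assms no_confocal_line[OF sW] not_line_plus_point[OF dW] by blast
  have i: "indep3 (q 1) (q 2) (q 3)" by (rule indep3_q) simp_all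
  have q1: "q 1 \<noteq> 0" using i[unfolded indep3_def, rule_format, of 1 0 0] by auto
  let ?L = "{x. B x (q 1) = 0}"
  let ?pt = "\<lambda>j. range (\<lambda>c::real. c *\<^sub>R (proj 1 - proj j))"
  \<comment> \<open>The kernel of \<open>proj 1 - proj j\<close> consists of the vectors orthogonal
    to both \<open>q 1\<close> and \<open>q j\<close>, a single projective point on the polar line
    of \<open>q 1\<close>.\<close>
  have foc: "focus (?pt j) \<in> PC ?L" if j: "j \<noteq> 1" for j
  proof -
    obtain k where k: "k \<noteq> 1" "k \<noteq> j" using third_index by blast
    have "indep3 (q 1) (q j) (q k)" using j k by (intro indep3_q) auto
    then have ind: "a = 0 \<and> b = 0" if "a *s q 1 + b *s q j = 0" for a b
      using that unfolding indep3_def by (metis add.right_neutral vec.scale_zero_left)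
    obtain f where f: "f \<noteq> 0" "B f (q 1) = 0" "B f (q j) = 0" by (rule exists_orthogonal)
    have "focus (?pt j) = {x. B x (q 1) = 0 \<and> B x (q j) = 0}"
      unfolding focus_real_point using proj_diff_kernel j by auto
    also have "\<dots> = range (\<lambda>c. c *s f)"
    proof
      show "{x. B x (q 1) = 0 \<and> B x (q j) = 0} \<subseteq> range (\<lambda>c. c *s f)"
      proof
        fix x assume "x \<in> {x. B x (q 1) = 0 \<and> B x (q j) = 0}"
        then obtain c where "x = c *s f" using orthogonal_unique[OF ind f, of x] by blast
        then show "x \<in> range (\<lambda>c. c *s f)" by (rule range_eqI)
      qed
      show "range (\<lambda>c. c *s f) \<subseteq> {x. B x (q 1) = 0 \<and> B x (q j) = 0}"
        using f by (auto simp: B_simps)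
    qed
    finally show ?thesis using f by (auto simp: proj_space_def)
  qed
  have dist: "?pt j \<noteq> ?pt k" if "j \<noteq> 1" "k \<noteq> 1" "j \<noteq> k" for j k
    using proj_diff_points_distinct[of 1 k j 1] that by auto
  have E: "?pt 2 \<in> E_cubic W" "?pt 3 \<in> E_cubic W" "?pt 4 \<in> E_cubic W"
    by (rule proj_diff_in_E_cubic; simp)+
  have D: "?pt 2 \<noteq> ?pt 3" "?pt 2 \<noteq> ?pt 4" "?pt 3 \<noteq> ?pt 4"
    by (rule dist; simp)+
  have F: "focus (?pt 2) \<in> PC ?L" "focus (?pt 3) \<in> PC ?L" "focus (?pt 4) \<in> PC ?L"
    by (rule foc; simp)+
  have L: "\<exists>L. vec.subspace L \<and> vec.dim L = 2 \<and> focus (?pt 2) \<in> PC L \<and> focus (?pt 3) \<in> PC L \<and>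
      focus (?pt 4) \<in> PC L \<and> \<not> PC L \<subseteq> focal_cubic W"
    by (intro exI[of _ ?L] conjI orthogonal_complement[OF q1] F hyperplane_not_in_focal_cubic[OF q1])
  show ?thesis
    unfolding real_family_def
    by (rule conjI[OF gen], rule bexI[OF _ E(1)], rule bexI[OF _ E(2)], rule bexI[OF _ E(3)])
      (intro conjI D L)
qed

end

lemma equitant_imp_real:
  assumes "equitant B W" "elliptic B W"
  shows "real_family B W"
proof -
  obtain q where q: "equitant_from B q W" using assms(1) unfolding equitant_def by (elim exE)
  have W: "W = {\<Sum>i\<in>UNIV. r i *\<^sub>R rank_one B (q i) (q i) | r :: 4 \<Rightarrow> real. (\<Sum>i\<in>UNIV. r i) = 0}"
    using q unfolding equitant_from_def by (elim conjE)
  have gp: "\<forall>i j k. i \<noteq> j \<and> i \<noteq> k \<and> j \<noteq> k \<longrightarrow>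
        \<not> (\<exists>L. vec.subspace L \<and> vec.dim L = 2 \<and> q i \<in> L \<and> q j \<in> L \<and> q k \<in> L)"
    using q unfolding equitant_from_def by (elim conjE)
  show ?thesis
    by (rule equitant_points_real[OF W _ assms(2)]) (use gp in blast)
qed

end

section \<open>The limiting case\<close>

context indefinite_form
begin

lemma rank_one_add_left: "rank_one B (u + v) w = rank_one B u w + rank_one B v w"
  and rank_one_add_right: "rank_one B w (u + v) = rank_one B w u + rank_one B w v"
  and rank_one_scale_left: "rank_one B (of_real c *s v) w = c *\<^sub>R rank_one B v w"
  and rank_one_scale_right: "rank_one B w (of_real c *s v) = c *\<^sub>R rank_one B w v"
  by (rule cmat_eqI; simp add: rank_one_mult matrix_vector_mult_add_rdistrib scaleR_mult_vec B_simps
      vec.scale_left_distrib vec.scale_right_distrib mult.commute)+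

lemmas rank_one_simps = rank_one_add_left rank_one_add_right rank_one_scale_left rank_one_scale_right

text \<open>
  A direction tangent at \<open>q\<close> to the rank one hermitian maps replaces the fourth point. All of \<open>W\<close> is
  real in the basis \<open>x, y, q\<close>, and \<open>p1, p2, p3, p4\<close> below are a common fibre of the map
  \<open>(a, b, c) \<mapsto> (a b, c (\<rho> a - b), a\<^sup>2 + b\<^sup>2 + c\<^sup>2 - t a c)\<close> whose components span the annihilator of \<open>W\<close>;
  the fibre over \<open>(0, 0, 1)\<close> is \<open>x, y, q\<close> with \<open>q\<close> doubled, and \<open>\<epsilon>\<close> moves away from it.
\<close>

lemma equitant_of_tangent_span:
  fixes \<rho> t :: real
  assumes tr: "\<And>h. h \<in> W \<Longrightarrow> trace h = 0"
    and p: "Re (B p p) < 0" "\<And>h. h \<in> W \<Longrightarrow> B (h *v p) p = 0"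
    and ind: "indep3 x y q" and \<rho>: "\<rho> \<noteq> 0" and z: "z = x + of_real \<rho> *s y"
    and W: "W = span {rank_one B x x - rank_one B q q, rank_one B y y - rank_one B q q,
      rank_one B q z + rank_one B z q + t *\<^sub>R rank_one B q q}"
  shows "equitant B W"
proof -
  \<comment> \<open>At \<epsilon> z + k q the third component of the map above is \<epsilon>^2 (1 +
    \<rho>^2) + k^2 - t \<epsilon> k. This \<epsilon> makes the first term 1/2, leaving 1/2 for the
    rest if the value is to be 1.\<close>
  define \<epsilon> where "\<epsilon> = sqrt (1 / (2 * (1 + \<rho>\<^sup>2)))"
  have rpos: "1 + \<rho>\<^sup>2 > 0" by (simp add: add_pos_nonneg)
  have eps: "\<epsilon> > 0" using rpos by (simp add: \<epsilon>_def)
  have eps2: "\<epsilon> * \<epsilon> = 1 / (2 * (1 + \<rho>\<^sup>2))" using rpos by (simp add: \<epsilon>_def)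
  then have eps_rho: "\<epsilon> * \<epsilon> + \<rho> * \<rho> * (\<epsilon> * \<epsilon>) = 1 / 2"
    using rpos by (simp add: field_simps power2_eq_square)
  define d where "d = 2 * \<rho> * (\<epsilon> * \<epsilon>)"
  have "\<bar>d\<bar> < 1"
  proof -
    have "0 \<le> (1 - \<bar>\<rho>\<bar>)\<^sup>2" by simp
    then have "2 * \<bar>\<rho>\<bar> \<le> 1 + \<rho>\<^sup>2" by (simp add: power2_diff)
    then have "\<bar>d\<bar> \<le> 1 / 2"
      unfolding d_def eps2 using rpos by (simp add: abs_mult field_simps)
    then show ?thesis by simp
  qed
  then have d: "1 + d > 0" "1 - d > 0" by simp_all
  \<comment> \<open>\<open>m\<close> and \<open>n\<close> solve m^2 + n^2 = 1 and 2 m n = d, via (m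
    + n)^2 = 1 + d and (m - n)^2 = 1 - d. This gives \<open>p1\<close> and \<open>p2\<close> the
    same product of the first two coordinates as \<open>p3\<close> and \<open>p4\<close>.\<close>
  define m where "m = (sqrt (1 + d) + sqrt (1 - d)) / 2"
  define n where "n = (sqrt (1 + d) - sqrt (1 - d)) / 2"
  have sq: "sqrt (1 + d) * sqrt (1 + d) = 1 + d" "sqrt (1 - d) * sqrt (1 - d) = 1 - d"
    using d by simp_all
  have mn: "m * n = \<rho> * (\<epsilon> * \<epsilon>)"
    using sq by (simp add: m_def n_def d_def field_simps)
  have mmnn: "m * m + n * n = 1"
    using sq by (simp add: m_def n_def field_simps)
  define \<delta> where "\<delta> = m * m - n * n"
  have "\<delta> = sqrt (1 + d) * sqrt (1 - d)" by (simp add: \<delta>_def m_def n_def field_simps)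
  then have \<delta>: "\<delta> > 0" using d by simp
  \<comment> \<open>The roots of k^2 - t \<epsilon> k - 1/2 = 0; the discriminant is positive and
    the product negative, so they are real, distinct and nonzero.\<close>
  define k3 where "k3 = (t * \<epsilon> + sqrt (t * \<epsilon> * (t * \<epsilon>) + 2)) / 2"
  define k4 where "k4 = (t * \<epsilon> - sqrt (t * \<epsilon> * (t * \<epsilon>) + 2)) / 2"
  have disc: "t * \<epsilon> * (t * \<epsilon>) + 2 > 0" using zero_le_square[of "t * \<epsilon>"] by linarith
  have sq2: "sqrt (t * \<epsilon> * (t * \<epsilon>) + 2) * sqrt (t * \<epsilon> * (t * \<epsilon>) + 2) = t * \<epsilon> * (t * \<epsilon>) + 2"
    using disc by simp
  have ksum: "k3 + k4 = t * \<epsilon>" by (simp add: k3_def k4_def field_simps)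
  have "k3 * k4 = (t * \<epsilon> * (t * \<epsilon>) - sqrt (t * \<epsilon> * (t * \<epsilon>) + 2) * sqrt (t * \<epsilon> * (t * \<epsilon>) + 2)) / 4"
    by (simp add: k3_def k4_def algebra_simps)
  then have kprod: "k3 * k4 = - 1 / 2" unfolding sq2 by simp
  define \<Delta> where "\<Delta> = k3 - k4"
  have \<Delta>: "\<Delta> > 0" using disc by (simp add: \<Delta>_def k3_def k4_def field_simps)
  have k30: "k3 \<noteq> 0" and k40: "k4 \<noteq> 0" using kprod by auto
  have kk: "k3 * k3 + k4 * k4 = t * t * (\<epsilon> * \<epsilon>) + 1"
  proof -
    have "k3 * k3 + k4 * k4 = (k3 + k4) * (k3 + k4) - 2 * (k3 * k4)" by (simp add: algebra_simps)
    then show ?thesis unfolding ksum kprod by (simp add: algebra_simps)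
  qed
  define p1 where "p1 = of_real m *s x + of_real n *s y"
  define p2 where "p2 = of_real n *s x + of_real m *s y"
  define p3 where "p3 = of_real \<epsilon> *s z + of_real k3 *s q"
  define p4 where "p4 = of_real \<epsilon> *s z + of_real k4 *s q"
  have ind': "indep3 p1 p2 p3" unfolding indep3_def
  proof (intro allI impI)
    fix a b c assume e: "a *s p1 + b *s p2 + c *s p3 = 0"
    have "(a * m + b * n + c * \<epsilon>) *s x + (a * n + b * m + c * \<epsilon> * \<rho>) *s y + (c * k3) *s q = 0"
      using e by (simp add: p1_def p2_def p3_def z vec.scale_left_distrib vec.scale_right_distrib
        algebra_simps)
    then have e3: "a * m + b * n + c * \<epsilon> = 0" "a * n + b * m + c * \<epsilon> * \<rho> = 0" "c * k3 = 0"
      using ind unfolding indep3_def by blast+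
    then have c: "c = 0" using k30 by simp
    then have e2: "a * m + b * n = 0" "a * n + b * m = 0" using e3 by simp_all
    have "of_real \<delta> * a = m * (a * m + b * n) - n * (a * n + b * m)"
      by (simp add: \<delta>_def algebra_simps)
    also have "\<dots> = 0" unfolding e2 by simp
    finally have a: "a = 0" using \<delta> by simp
    have "of_real \<delta> * b = m * (a * n + b * m) - n * (a * m + b * n)"
      by (simp add: \<delta>_def algebra_simps)
    also have "\<dots> = 0" unfolding e2 by simp
    finally have "b = 0" using \<delta> by simp
    then show "a = 0 \<and> b = 0 \<and> c = 0" using a c by simp
  qed
  \<comment> \<open>Coordinates of \<open>z\<close> with respect to \<open>p1\<close>,
    \<open>p2\<close>, by Cramer's rule with determinant \<delta>. General position requires both to
    be nonzero: if one vanished, m^2 + n^2 would be \<epsilon>^2 (1 + \<rho>^2) = 1/2 instead of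
    1.\<close>
  define \<alpha> where "\<alpha> = (m - \<rho> * n) / \<delta>"
  define \<beta> where "\<beta> = (\<rho> * m - n) / \<delta>"
  have \<alpha>0: "\<alpha> \<noteq> 0"
  proof
    assume "\<alpha> = 0"
    then have m: "m = \<rho> * n" using \<delta> by (simp add: \<alpha>_def)
    then have "n * n = \<epsilon> * \<epsilon>" using mn \<rho> by (simp add: mult.assoc)
    moreover have "m * m = \<rho> * \<rho> * (n * n)" using m by (simp add: algebra_simps)
    ultimately show False using mmnn eps_rho by simp
  qed
  have \<beta>0: "\<beta> \<noteq> 0"
  proof
    assume "\<beta> = 0"
    then have n: "n = \<rho> * m" using \<delta> by (simp add: \<beta>_def)
    then have "m * m = \<epsilon> * \<epsilon>" using mn \<rho> by (simp add: mult.left_commute)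
    moreover have "n * n = \<rho> * \<rho> * (m * m)" using n by (simp add: algebra_simps)
    ultimately show False using mmnn eps_rho by simp
  qed
  have ab: "\<alpha> * m + \<beta> * n = 1" "\<alpha> * n + \<beta> * m = \<rho>"
    using \<delta> by (simp_all add: \<alpha>_def \<beta>_def field_simps) (simp_all add: \<delta>_def algebra_simps)
  have zp: "z = of_real \<alpha> *s p1 + of_real \<beta> *s p2"
  proof -
    have "of_real \<alpha> *s p1 + of_real \<beta> *s p2 = of_real (\<alpha> * m + \<beta> * n) *s x + of_real (\<alpha> * n + \<beta> * m) *s y"
      by (simp add: p1_def p2_def vec.scale_left_distrib vec.scale_right_distrib algebra_simps)
    then show ?thesis unfolding ab z by simp
  qed
  have "q = of_real (1 / k3) *s (p3 - of_real \<epsilon> *s z)" using k30 by (simp add: p3_def)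
  then have "p4 = of_real \<epsilon> *s z + of_real (k4 / k3) *s (p3 - of_real \<epsilon> *s z)"
    by (simp add: p4_def)
  also have "\<dots> = of_real (\<epsilon> * (1 - k4 / k3)) *s z + of_real (k4 / k3) *s p3"
    by (simp add: vec.scale_right_diff_distrib vec.scale_left_diff_distrib right_diff_distrib mult.commute)
  also have "\<dots> = of_real (\<epsilon> * (1 - k4 / k3) * \<alpha>) *s p1 + of_real (\<epsilon> * (1 - k4 / k3) * \<beta>) *s p2
      + of_real (k4 / k3) *s p3"
    unfolding zp by (simp add: vec.scale_right_distrib)
  finally have p4: "p4 = of_real (\<epsilon> * (1 - k4 / k3) * \<alpha>) *s p1 + of_real (\<epsilon> * (1 - k4 / k3) * \<beta>) *s p2
      + of_real (k4 / k3) *s p3" .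
  have nz: "1 - k4 / k3 \<noteq> 0" using \<Delta> k30 by (simp add: \<Delta>_def field_simps)
  let ?P = "\<lambda>x. rank_one B x x"
  define S where "S = rank_one B x y + rank_one B y x"
  define T where "T = rank_one B q z + rank_one B z q"
  have P1: "?P p1 = (m * m) *\<^sub>R ?P x + (n * n) *\<^sub>R ?P y + (m * n) *\<^sub>R S"
    by (simp add: p1_def S_def rank_one_simps algebra_simps)
  have P2: "?P p2 = (n * n) *\<^sub>R ?P x + (m * m) *\<^sub>R ?P y + (m * n) *\<^sub>R S"
    by (simp add: p2_def S_def rank_one_simps algebra_simps)
  have Pz: "?P z = ?P x + (\<rho> * \<rho>) *\<^sub>R ?P y + \<rho> *\<^sub>R S"
    by (simp add: z S_def rank_one_simps algebra_simps)
  have Pk: "?P (of_real \<epsilon> *s z + of_real k *s q) = (\<epsilon> * \<epsilon>) *\<^sub>R ?P z + (\<epsilon> * k) *\<^sub>R T + (k * k) *\<^sub>R ?P q" for k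
    by (simp add: T_def rank_one_simps algebra_simps)
  define H1 where "H1 = ?P x - ?P q"
  define H2 where "H2 = ?P y - ?P q"
  define H3 where "H3 = T + t *\<^sub>R ?P q"
  have P34: "?P p3 - ?P p4 = (\<epsilon> * \<Delta>) *\<^sub>R H3"
  proof -
    have "?P p3 - ?P p4 = (\<epsilon> * \<Delta>) *\<^sub>R T + ((k3 - k4) * (k3 + k4)) *\<^sub>R ?P q"
      unfolding p3_def p4_def Pk \<Delta>_def by (simp add: algebra_simps)
    also have "(k3 - k4) * (k3 + k4) = (\<epsilon> * \<Delta>) * t" unfolding ksum \<Delta>_def by simp
    finally show ?thesis by (simp add: H3_def scaleR_add_right)
  qed
  have P12: "?P p1 - ?P p2 = \<delta> *\<^sub>R (H1 - H2)"
    unfolding P1 P2 \<delta>_def H1_def H2_def by (simp add: algebra_simps)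
  \<comment> \<open>The cross term \<open>S\<close> cancels because m n = \<rho> \<epsilon>^2. The
    two differences above gave multiples of \<open>H3\<close> and \<open>H1 - H2\<close>; this
    combination supplies the third generator.\<close>
  have D: "?P p1 + ?P p2 - ?P p3 - ?P p4 = (1 - 2 * (\<epsilon> * \<epsilon>)) *\<^sub>R H1 + (1 - 2 * (\<rho> * \<rho> * (\<epsilon> * \<epsilon>))) *\<^sub>R H2
      - (t * (\<epsilon> * \<epsilon>)) *\<^sub>R H3"
  proof -
    have "?P p1 + ?P p2 = (m * m + n * n) *\<^sub>R ?P x + (m * m + n * n) *\<^sub>R ?P y + (m * n + m * n) *\<^sub>R S"
      by (simp only: P1 P2 scaleR_add_left add_ac)
    then have s12: "?P p1 + ?P p2 = ?P x + ?P y + (2 * (\<epsilon> * \<epsilon>) * \<rho>) *\<^sub>R S"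
      unfolding mmnn mn by (simp add: mult.commute)
    have "?P p3 + ?P p4 = (2 * (\<epsilon> * \<epsilon>)) *\<^sub>R ?P z + (\<epsilon> * (k3 + k4)) *\<^sub>R T + (k3 * k3 + k4 * k4) *\<^sub>R ?P q"
      by (simp only: p3_def p4_def Pk scaleR_add_left distrib_left mult_2 distrib_right add_ac)
    then have s34: "?P p3 + ?P p4 = (2 * (\<epsilon> * \<epsilon>)) *\<^sub>R ?P z + (t * (\<epsilon> * \<epsilon>)) *\<^sub>R T
        + (2 - 2 * (\<epsilon> * \<epsilon> + \<rho> * \<rho> * (\<epsilon> * \<epsilon>)) + t * t * (\<epsilon> * \<epsilon>)) *\<^sub>R ?P q"
      unfolding kk ksum eps_rho by (simp add: algebra_simps)
    have "?P p1 + ?P p2 - ?P p3 - ?P p4 = (?P p1 + ?P p2) - (?P p3 + ?P p4)" by simp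
    also have "\<dots> = (1 - 2 * (\<epsilon> * \<epsilon>)) *\<^sub>R ?P x + (1 - 2 * (\<rho> * \<rho> * (\<epsilon> * \<epsilon>))) *\<^sub>R ?P y
      - (t * (\<epsilon> * \<epsilon>)) *\<^sub>R T
      - (2 - 2 * (\<epsilon> * \<epsilon> + \<rho> * \<rho> * (\<epsilon> * \<epsilon>)) + t * t * (\<epsilon> * \<epsilon>)) *\<^sub>R ?P q"
      unfolding s12 s34 Pz by (simp add: algebra_simps)
    also have "\<dots> = (1 - 2 * (\<epsilon> * \<epsilon>)) *\<^sub>R H1 + (1 - 2 * (\<rho> * \<rho> * (\<epsilon> * \<epsilon>))) *\<^sub>R H2
      - (t * (\<epsilon> * \<epsilon>)) *\<^sub>R H3"
      unfolding H1_def H2_def H3_def by (simp add: algebra_simps scaleR_2)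
    finally show ?thesis .
  qed
  have W': "W = span {H1, H2, H3}" unfolding W H1_def H2_def H3_def T_def ..
  let ?G = "{?P p1 - ?P p4, ?P p2 - ?P p4, ?P p3 - ?P p4}"
  have H: "H1 \<in> span {H1, H2, H3}" "H2 \<in> span {H1, H2, H3}" "H3 \<in> span {H1, H2, H3}"
    by (simp_all add: span_base)
  define E where "E = ?P p1 + ?P p2 - ?P p3 - ?P p4"
  have E: "E \<in> span {H1, H2, H3}"
    unfolding E_def D by (intro span_diff span_add span_scale H)
  have F: "?P p1 - ?P p2 \<in> span {H1, H2, H3}" "?P p3 - ?P p4 \<in> span {H1, H2, H3}"
    unfolding P12 P34 by (intro span_diff span_scale H)+
  have "?P p1 - ?P p4 = (1 / 2) *\<^sub>R (E + (?P p1 - ?P p2) + (?P p3 - ?P p4))"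
  proof -
    have "E + (?P p1 - ?P p2) + (?P p3 - ?P p4) = 2 *\<^sub>R (?P p1 - ?P p4)"
      by (simp add: E_def scaleR_2)
    then show ?thesis by simp
  qed
  then have G1: "?P p1 - ?P p4 \<in> span {H1, H2, H3}"
    using E F by (metis span_add span_scale)
  have "?P p2 - ?P p4 = (?P p1 - ?P p4) - (?P p1 - ?P p2)" by simp
  then have G2: "?P p2 - ?P p4 \<in> span {H1, H2, H3}" using G1 F(1) by (metis span_diff)
  have g: "?P p1 - ?P p4 \<in> span ?G" "?P p2 - ?P p4 \<in> span ?G" "?P p3 - ?P p4 \<in> span ?G"
    by (simp_all add: span_base)
  have "H3 = (1 / (\<epsilon> * \<Delta>)) *\<^sub>R (?P p3 - ?P p4)" unfolding P34 using eps \<Delta> by simp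
  then have K3: "H3 \<in> span ?G" using g(3) by (metis span_scale)
  have "H1 - H2 = (1 / \<delta>) *\<^sub>R ((?P p1 - ?P p4) - (?P p2 - ?P p4))" using P12 \<delta> by simp
  then have K12: "H1 - H2 \<in> span ?G" using g(1,2) by (metis span_scale span_diff)
  have EG: "E \<in> span ?G"
  proof -
    have "E = (?P p1 - ?P p4) + (?P p2 - ?P p4) - (?P p3 - ?P p4)" by (simp add: E_def)
    then show ?thesis using g by (metis span_add span_diff)
  qed
  \<comment> \<open>The coefficients of \<open>H1\<close> add up to 2 - 2 \<epsilon>^2 (1 +
    \<rho>^2) = 1, so \<open>H1\<close>, and then \<open>H2\<close>, is recovered from the new
    generators.\<close>
  have "H1 = E + (t * (\<epsilon> * \<epsilon>)) *\<^sub>R H3 + (1 - 2 * (\<rho> * \<rho> * (\<epsilon> * \<epsilon>))) *\<^sub>R (H1 - H2)"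
  proof -
    have "E + (t * (\<epsilon> * \<epsilon>)) *\<^sub>R H3 + (1 - 2 * (\<rho> * \<rho> * (\<epsilon> * \<epsilon>))) *\<^sub>R (H1 - H2)
      = (2 - 2 * (\<epsilon> * \<epsilon> + \<rho> * \<rho> * (\<epsilon> * \<epsilon>))) *\<^sub>R H1"
      unfolding E_def D by (simp add: algebra_simps scaleR_2)
    then show ?thesis unfolding eps_rho by simp
  qed
  then have K1: "H1 \<in> span ?G" using EG K3 K12 by (metis span_add span_scale)
  have "H2 = H1 - (H1 - H2)" by simp
  then have K2: "H2 \<in> span ?G" using K1 K12 by (metis span_diff)
  have "span {H1, H2, H3} = span ?G"
    by (intro subset_antisym span_minimal subspace_span) (use K1 K2 K3 G1 G2 F in auto)
  then have WG: "W = span ?G" unfolding W' .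
  show ?thesis
    by (rule equitantI[OF tr p ind' p4 _ _ _ WG]) (use \<alpha>0 \<beta>0 eps nz k30 k40 in auto)
qed

end

section \<open>Real families are equitant\<close>

text \<open>Genericity is used in this form: members of \<open>W\<close> that are independent over
  the reals share no nonzero kernel vector.\<close>

lemma confocalI:
  assumes W: "subspace W" "h1 \<in> W" "h2 \<in> W"
    and ind: "\<And>a b :: real. a *\<^sub>R h1 + b *\<^sub>R h2 = 0 \<Longrightarrow> a = 0 \<and> b = 0"
    and f: "f \<noteq> 0" "h1 *v f = 0" "h2 *v f = 0"
  shows "has_confocal_line W"
proof -
  let ?L = "span {h1, h2}"
  have L: "h \<in> W \<and> h *v f = 0" if "h \<in> ?L" for h
  proof -
    obtain a b where h: "h = a *\<^sub>R h1 + b *\<^sub>R h2"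
      using \<open>h \<in> ?L\<close> unfolding real_vector.span_pair_iff by blast
    show ?thesis unfolding h using W f
      by (simp add: subspace_add subspace_scale matrix_vector_mult_add_rdistrib scaleR_mult_vec)
  qed
  have "dim ?L = 2"
    using real_vector.independent_pairI[of h1 h2, OF ind] by (simp add: dim_eq_card_independent)
  moreover have "PR_mat ?L \<subseteq> E_cubic W"
    using L f(1) by (auto simp: proj_space_def[of _ ?L] intro!: E_cubicI)
  ultimately show ?thesis
    unfolding has_confocal_line_def
    using L f(1) subspace_span[of "{h1, h2}"] by (intro exI[of _ ?L] exI[of _ f]) simp
qed

lemma cmat_eq_on_basis:
  assumes "indep3 u v w" "h *v u = k *v u" "h *v v = k *v v" "h *v w = k *v w"
  shows "h = (k :: cmat)"
proof (rule cmat_eqI)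
  fix x
  obtain a b c where "x = a *s u + b *s v + c *s w" using assms(1) by (rule indep3_span)
  then show "h *v x = k *v x" using assms by (simp add: vec.add vec.scale)
qed

lemma span_scale3:
  fixes a b c :: "'a::real_vector"
  assumes "r \<noteq> 0" "s \<noteq> 0" "t \<noteq> 0"
  shows "span {r *\<^sub>R a, s *\<^sub>R b, t *\<^sub>R c} = span {a, b, c}"
proof (intro subset_antisym span_minimal subspace_span)
  show "{r *\<^sub>R a, s *\<^sub>R b, t *\<^sub>R c} \<subseteq> span {a, b, c}"
    unfolding insert_subset by (intro conjI span_scale span_base empty_subsetI) auto
  have "x \<in> span S" if "k *\<^sub>R x \<in> S" "k \<noteq> 0" for x :: 'a and k S
    using span_scale[OF span_base[OF that(1)], of "1 / k"] that(2) by simp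
  from this[OF _ assms(1)] this[OF _ assms(2)] this[OF _ assms(3)]
  show "{a, b, c} \<subseteq> span {r *\<^sub>R a, s *\<^sub>R b, t *\<^sub>R c}"
    unfolding insert_subset by (intro conjI empty_subsetI) simp_all
qed

lemma real_if_cnj_eq: "cnj z = z \<Longrightarrow> of_real (Re z) = z"
  by (simp add: complex_eq_iff)

section \<open>Self-adjoint maps of rank at most 1\<close>

context indefinite_form
begin

text \<open>Eliminating \<open>e3\<close> from \<open>p\<close> and \<open>q\<close> gives
  \<open>z\<close> in the positive definite plane of \<open>e1\<close>, \<open>e2\<close>. As
  \<open>q\<close> is null and orthogonal to \<open>p\<close>, \<open>B z z\<close> is a nonnegative
  multiple of \<open>B p p\<close>. The signs agree only if \<open>q3 = 0\<close>, and then
  \<open>q\<close> is a null vector of that plane.\<close>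

lemma null_orthogonal_to_negative:
  assumes p: "Re (B p p) < 0" and q: "B p q = 0" "B q q = 0"
  shows "q = 0"
proof -
  obtain e1 e2 e3 where e: "B e1 e2 = 0" "B e1 e3 = 0" "B e2 e3 = 0"
    "Re (B e1 e1) > 0" "Re (B e2 e2) > 0" "Re (B e3 e3) < 0" "indep3 e1 e2 e3"
    by (rule orthogonal_basis)
  have e21: "B e2 e1 = 0" using e(1) B_eq_0_commute by blast
  have pos: "Re (B z z) = (cmod a)\<^sup>2 * Re (B e1 e1) + (cmod b)\<^sup>2 * Re (B e2 e2)"
    if "z = a *s e1 + b *s e2" for z a b
  proof -
    have "B z z = (a * cnj a) * B e1 e1 + (b * cnj b) * B e2 e2"
      unfolding that by (simp add: B_simps e(1) e21 algebra_simps)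
    also have "\<dots> = of_real ((cmod a)\<^sup>2) * B e1 e1 + of_real ((cmod b)\<^sup>2) * B e2 e2"
      unfolding complex_norm_square ..
    finally show ?thesis by (simp flip: of_real_power)
  qed
  obtain p1 p2 p3 where pe: "p = p1 *s e1 + p2 *s e2 + p3 *s e3" using e(7) by (rule indep3_span)
  obtain q1 q2 q3 where qe: "q = q1 *s e1 + q2 *s e2 + q3 *s e3" using e(7) by (rule indep3_span)
  define z where "z = p3 *s q - q3 *s p"
  have z: "z = (p3 * q1 - q3 * p1) *s e1 + (p3 * q2 - q3 * p2) *s e2"
    unfolding z_def pe qe by (simp add: vec.scale_right_distrib vec.scale_left_diff_distrib algebra_simps)
  have qp: "B q p = 0" using q(1) B_eq_0_commute by blast
  have "B z z = (q3 * cnj q3) * B p p"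
    unfolding z_def by (simp add: B_simps q qp algebra_simps)
  also have "\<dots> = of_real ((cmod q3)\<^sup>2) * B p p" unfolding complex_norm_square ..
  finally have "Re (B z z) = (cmod q3)\<^sup>2 * Re (B p p)" by (simp flip: of_real_power)
  moreover have "Re (B z z) \<ge> 0"
    unfolding pos[OF z] using e by (intro add_nonneg_nonneg mult_nonneg_nonneg) simp_all
  ultimately have "q3 = 0" using p by (metis mult_pos_neg not_less zero_less_norm_iff zero_less_power)
  then have q': "q = q1 *s e1 + q2 *s e2" using qe by simp
  have "(cmod q1)\<^sup>2 * Re (B e1 e1) + (cmod q2)\<^sup>2 * Re (B e2 e2) = 0"
    using pos[OF q'] q(2) by simp
  moreover have "(cmod q1)\<^sup>2 * Re (B e1 e1) \<ge> 0" "(cmod q2)\<^sup>2 * Re (B e2 e2) \<ge> 0"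
    using e by (simp_all add: mult_nonneg_nonneg)
  ultimately have "(cmod q1)\<^sup>2 * Re (B e1 e1) = 0" "(cmod q2)\<^sup>2 * Re (B e2 e2) = 0"
    by linarith+
  then show "q = 0" using q' e by simp
qed

text \<open>By self-adjointness the image of \<open>k\<close> is orthogonal to \<open>f\<close> and
  \<open>g\<close>, so it lies in the line of \<open>q\<close>. One further basis vector
  \<open>w\<close> determines \<open>k\<close>, and the symmetry of the pairing of
  \<open>k w\<close> with \<open>w\<close> makes the factor real.\<close>

lemma self_adjoint_killing_pair:
  assumes sa: "\<And>x y. B (k *v x) y = B x (k *v y)"
    and ind: "\<And>a b. a *s f + b *s g = 0 \<Longrightarrow> a = 0 \<and> b = 0"
    and k: "k *v f = 0" "k *v g = 0"
    and q: "q \<noteq> 0" "B q f = 0" "B q g = 0"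
  obtains \<beta> :: real where "k = \<beta> *\<^sub>R rank_one B q q"
proof -
  obtain w where w: "indep3 f g w" using extend_pair[OF ind] .
  have qw: "B q w \<noteq> 0" using indep3_orthogonal[OF w] q by blast
  then have wq: "B w q \<noteq> 0" using B_eq_0_commute by blast
  have "B (k *v w) f = 0" "B (k *v w) g = 0" using sa k by simp_all
  then obtain c where c: "k *v w = c *s q" using orthogonal_unique[OF ind q, of "k *v w"] by blast
  have "c * B q w = cnj c * B w q"
    using sa[of w w] by (simp add: c B_simps)
  then have "cnj (c / B w q) = c / B w q"
    using qw wq B_commute[of q w] by (simp add: field_simps)
  then have r: "of_real (Re (c / B w q)) = c / B w q" by (rule real_if_cnj_eq)
  have fq: "B f q = 0" "B g q = 0" using q B_eq_0_commute by blast+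
  have "k = Re (c / B w q) *\<^sub>R rank_one B q q"
    by (rule cmat_eq_on_basis[OF w])
      (use wq in \<open>simp_all only: scaleR_mult_vec rank_one_mult r k c fq, simp_all\<close>)
  then show ?thesis by (rule that)
qed

context
  fixes W :: "cmat set" and p :: cvec
  assumes sW: "subspace W"
    and tr: "\<And>h. h \<in> W \<Longrightarrow> trace h = 0"
    and sa: "\<And>h x y. h \<in> W \<Longrightarrow> B (h *v x) y = B x (h *v y)"
    and p: "Re (B p p) < 0" "\<And>h. h \<in> W \<Longrightarrow> B (h *v p) p = 0"
begin

text \<open>Such an \<open>h\<close> is a real multiple of \<open>rank_one B q q\<close>. If the
  multiple were nonzero, the trace and the condition at \<open>p\<close> would make \<open>q\<close>
  null and orthogonal to the negative vector \<open>p\<close>.\<close>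

lemma no_real_rank_one:
  assumes h: "h \<in> W" "h *v f = 0" "h *v g = 0"
    and ind: "\<And>a b. a *s f + b *s g = 0 \<Longrightarrow> a = 0 \<and> b = 0"
  shows "h = 0"
proof -
  obtain q where q: "q \<noteq> 0" "B q f = 0" "B q g = 0" by (rule exists_orthogonal)
  obtain \<beta> where \<beta>: "h = \<beta> *\<^sub>R rank_one B q q"
    using self_adjoint_killing_pair[OF sa[OF h(1)] ind h(2,3) q] by blast
  have "trace h = of_real \<beta> * B q q"
    unfolding \<beta> by (simp add: trace_def sum_distrib_left scaleR_conv_of_real[where 'a=complex]
      flip: trace_rank_one)
  moreover have "B (h *v p) p = of_real \<beta> * of_real ((cmod (B p q))\<^sup>2)"
    unfolding \<beta> mult_B_commute[symmetric] by (simp add: scaleR_mult_vec rank_one_mult B_simps)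
  ultimately have "\<beta> = 0 \<or> (B q q = 0 \<and> B p q = 0)" using tr[OF h(1)] p(2)[OF h(1)] by auto
  then have "\<beta> = 0" using null_orthogonal_to_negative[OF p(1)] q(1) by blast
  then show ?thesis using \<beta> by simp
qed

text \<open>
  Elements \<open>h1 + i h2\<close> of the complexification have rank at least 2: a kernel of dimension 2 meets that
  of the adjoint \<open>h1 - i h2\<close>, and a common kernel vector produces a confocal line.
\<close>

lemma complex_kernel:
  assumes nc: "\<not> has_confocal_line W"
    and h: "h1 \<in> W" "h2 \<in> W"
    and ind: "\<And>a b. a *s f + b *s g = 0 \<Longrightarrow> a = 0 \<and> b = 0"
    and f: "h1 *v f + \<i> *s (h2 *v f) = 0" and g: "h1 *v g + \<i> *s (h2 *v g) = 0"
  shows "h1 = 0 \<and> h2 = 0"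
proof (cases "\<forall>a b :: real. a *\<^sub>R h1 + b *\<^sub>R h2 = 0 \<longrightarrow> a = 0 \<and> b = 0")
  case True
  obtain q where q: "q \<noteq> 0" "B q f = 0" "B q g = 0" by (rule exists_orthogonal)
  have image: "\<exists>c. h1 *v y - \<i> *s (h2 *v y) = c *s q" for y
  proof -
    have adj: "B (h1 *v y - \<i> *s (h2 *v y)) x = B y (h1 *v x + \<i> *s (h2 *v x))" for x
      by (simp add: B_simps sa[OF h(1)] sa[OF h(2)])
    have "B (h1 *v y - \<i> *s (h2 *v y)) f = 0" "B (h1 *v y - \<i> *s (h2 *v y)) g = 0"
      unfolding adj f g by simp_all
    then show ?thesis using orthogonal_unique[OF ind q] by blast
  qed
  obtain c where c: "h1 *v f - \<i> *s (h2 *v f) = c *s q" using image by blast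
  obtain d where d: "h1 *v g - \<i> *s (h2 *v g) = d *s q" using image by blast
  \<comment> \<open>The adjoint takes \<open>f\<close> and \<open>g\<close> to multiples of the same
    \<open>q\<close>, so it kills a nonzero combination \<open>f0\<close> of them. Killed by both
    \<open>h1 + i h2\<close> and \<open>h1 - i h2\<close>, \<open>f0\<close> is killed by
    \<open>h1\<close> and \<open>h2\<close> separately.\<close>
  obtain a b where ab: "a \<noteq> 0 \<or> b \<noteq> 0" "a * c + b * d = 0"
  proof (cases "c = 0 \<and> d = 0")
    case True then show ?thesis using that[of 1 0] by simp
  next
    case False then show ?thesis using that[of d "- c"] by auto
  qed
  define f0 where "f0 = a *s f + b *s g"
  have f0: "f0 \<noteq> 0" using ind ab(1) unfolding f0_def by blast
  have e1: "h1 *v f0 + \<i> *s (h2 *v f0) = 0"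
  proof -
    have "h1 *v f0 + \<i> *s (h2 *v f0) = a *s (h1 *v f + \<i> *s (h2 *v f)) + b *s (h1 *v g + \<i> *s (h2 *v g))"
      by (simp add: f0_def vec.add vec.scale vec.scale_right_distrib mult.commute)
    then show ?thesis unfolding f g by simp
  qed
  have e2: "h1 *v f0 - \<i> *s (h2 *v f0) = 0"
  proof -
    have "h1 *v f0 - \<i> *s (h2 *v f0) = a *s (h1 *v f - \<i> *s (h2 *v f)) + b *s (h1 *v g - \<i> *s (h2 *v g))"
      by (simp add: f0_def vec.add vec.scale vec.scale_right_distrib vec.scale_right_diff_distrib mult.commute)
    also have "\<dots> = (a * c + b * d) *s q" unfolding c d by (simp add: vec.scale_left_distrib)
    finally show ?thesis by (simp add: ab(2))
  qed
  have "(h1 *v f0 + \<i> *s (h2 *v f0)) + (h1 *v f0 - \<i> *s (h2 *v f0)) = 0" unfolding e1 e2 by simp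
  then have "2 *s (h1 *v f0) = 0" by (simp add: vec_eq_iff)
  then have k1: "h1 *v f0 = 0" by simp
  then have k2: "h2 *v f0 = 0" using e1 by simp
  have "has_confocal_line W"
    using confocalI[OF sW h _ f0 k1 k2] True by blast
  then show ?thesis using nc by blast
next
  case False
  then obtain a b :: real where ab: "a *\<^sub>R h1 + b *\<^sub>R h2 = 0" "a \<noteq> 0 \<or> b \<noteq> 0" by blast
  \<comment> \<open>Here \<open>h1 + i h2\<close> is a multiple, by the nonzero number
    \<open>b - i a\<close>, of a real member of \<open>W\<close>; so its kernel vectors are killed
    by \<open>h1\<close> and by \<open>h2\<close>.\<close>
  have kill: "h1 *v x = 0 \<and> h2 *v x = 0" if x: "h1 *v x + \<i> *s (h2 *v x) = 0" for x
  proof -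
    have "(a *\<^sub>R h1 + b *\<^sub>R h2) *v x = 0" unfolding ab(1) by simp
    then have "of_real a *s (h1 *v x) + of_real b *s (h2 *v x) = 0"
      by (simp add: matrix_vector_mult_add_rdistrib scaleR_mult_vec)
    then have e: "of_real a * (h1 *v x) $ i + of_real b * (h2 *v x) $ i = 0"
      and e': "(h1 *v x) $ i + \<i> * (h2 *v x) $ i = 0" for i
      using x by (simp_all add: vec_eq_iff)
    have "(h2 *v x) $ i = 0" for i
    proof -
      have "(h1 *v x) $ i = - (\<i> * (h2 *v x) $ i)" using e' by (simp add: eq_neg_iff_add_eq_0)
      then have "(of_real b - \<i> * of_real a) * (h2 *v x) $ i = 0" using e[of i] by (simp add: algebra_simps)
      moreover have "of_real b - \<i> * of_real a \<noteq> 0" using ab(2) by (auto simp: complex_eq_iff)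
      ultimately show ?thesis unfolding mult_eq_0_iff by blast
    qed
    then have "h2 *v x = 0" by (simp add: vec_eq_iff)
    then show ?thesis using x by simp
  qed
  show ?thesis using kill[OF f] kill[OF g] no_real_rank_one ind h by blast
qed

text \<open>By \<open>complex_kernel\<close>, a nonzero \<open>h1 + i h2\<close> killing
  \<open>f\<close> has kernel exactly the line of \<open>f\<close>, which would thus belong to the
  focal cubic. So evaluation at a point outside \<open>E\<close> is injective on the
  complexification.\<close>

lemma not_focus_imp_zero:
  assumes nc: "\<not> has_confocal_line W"
    and f: "f \<noteq> 0" "range (\<lambda>c. c *s f) \<notin> focal_cubic W"
    and h: "h1 \<in> W" "h2 \<in> W" "h1 *v f + \<i> *s (h2 *v f) = 0"
  shows "h1 = 0 \<and> h2 = 0"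
proof (rule ccontr)
  assume nz: "\<not> (h1 = 0 \<and> h2 = 0)"
  define h where "h = h1 + cscale \<i> h2"
  have hx: "h *v x = h1 *v x + \<i> *s (h2 *v x)" for x
    by (simp add: h_def matrix_vector_mult_add_rdistrib cscale_mult_vec)
  have multiple: "\<exists>c. x = c *s f" if x: "h *v x = 0" for x
  proof (rule ccontr)
    assume n: "\<nexists>c. x = c *s f"
    then have "a = 0 \<and> b = 0" if "a *s f + b *s x = 0" for a b
      by (intro independent_pair_if_not_multiple[OF f(1) _ that]) blast
    then show False using complex_kernel[OF nc h(1,2) _ h(3), of x] x nz unfolding hx by blast
  qed
  have "h \<noteq> 0"
  proof
    assume "h = 0"
    then have all: "\<exists>c. x = c *s f" for x by (intro multiple) simp
    obtain v w where i: "indep3 f v w" using f(1) by (rule extend_single)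
    obtain c where "v = c *s f" using all by blast
    then show False using i[unfolded indep3_def, rule_format, of c "-1" 0] by simp
  qed
  have hf: "h *v f = 0" unfolding hx by (rule h(3))
  have "det (cscale c h) = 0" for c
    by (rule det_eq_0I[OF _ f(1)]) (simp add: cscale_mult_vec hf)
  moreover have "h \<in> complexification W" using h by (auto simp: complexification_def h_def)
  ultimately have "range (\<lambda>c. cscale c h) \<in> E_hat W"
    using \<open>h \<noteq> 0\<close> by (auto simp: E_hat_def proj_space_def)
  moreover have "focus (range (\<lambda>c. cscale c h)) = range (\<lambda>c. c *s f)"
    unfolding focus_complex_point using multiple hf by (auto simp: vec.scale)
  ultimately show False using f(2) by (auto simp: focal_cubic_def)
qed

text \<open>With \<open>v = h g\<close>, subtracting \<open>rank_one B v v\<close> divided by the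
  real number \<open>B v g\<close> leaves a self-adjoint map killing both \<open>f\<close> and
  \<open>g\<close>, hence a real multiple of \<open>rank_one B q q\<close>.\<close>

lemma split_off_squares:
  assumes h: "h \<in> W" "h *v f = 0"
    and ind: "\<And>a b. a *s f + b *s g = 0 \<Longrightarrow> a = 0 \<and> b = 0"
    and q: "q \<noteq> 0" "B q f = 0" "B q g = 0"
    and nz: "B (h *v g) g \<noteq> 0"
  obtains \<beta> :: real where
    "h = (1 / Re (B (h *v g) g)) *\<^sub>R rank_one B (h *v g) (h *v g) + \<beta> *\<^sub>R rank_one B q q"
proof -
  define v where "v = h *v g"
  have r: "B v g = B g v" unfolding v_def using sa[OF h(1)] .
  then have a: "of_real (Re (B v g)) = B v g"
    using B_commute[of g v] by (intro real_if_cnj_eq) simp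
  define k where "k = h - (1 / Re (B v g)) *\<^sub>R rank_one B v v"
  have kx: "k *v x = h *v x - (B x v / B v g) *s v" for x
    by (simp add: k_def matrix_vector_mult_diff_rdistrib scaleR_mult_vec rank_one_mult a)
  have "B (k *v x) y = B x (k *v y)" for x y
  proof -
    have c: "cnj (B v g) = B v g" using r B_commute[of v g] by simp
    show ?thesis
      unfolding kx using B_commute[of v y] by (simp add: B_simps sa[OF h(1)] c)
  qed
  moreover have "k *v f = 0"
    unfolding kx using h sa[OF h(1), of f g] by (simp add: v_def)
  moreover have "k *v g = 0"
    unfolding kx r[symmetric] using nz by (simp add: v_def)
  ultimately obtain \<beta> where "k = \<beta> *\<^sub>R rank_one B q q"
    using self_adjoint_killing_pair[OF _ ind _ _ q] by metis
  then have "h = (1 / Re (B v g)) *\<^sub>R rank_one B v v + \<beta> *\<^sub>R rank_one B q q"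
    by (simp add: k_def algebra_simps)
  then show ?thesis unfolding v_def by (rule that)
qed

text \<open>The condition at \<open>p\<close> makes the coefficients of the two squares opposite in
  sign, and rescaling \<open>h g\<close> by the ratio of the moduli of the pairings of
  \<open>q\<close> and \<open>h g\<close> with \<open>p\<close> makes them equal in size.\<close>

lemma split_normalised:
  assumes h: "h \<in> W" "h *v f = 0"
    and ind: "\<And>a b. a *s f + b *s g = 0 \<Longrightarrow> a = 0 \<and> b = 0"
    and q: "q \<noteq> 0" "B q f = 0" "B q g = 0" "B p q \<noteq> 0"
    and nz: "B (h *v g) g \<noteq> 0"
  obtains s \<kappa> :: real where "s \<noteq> 0" "\<kappa> > 0"
    "h = s *\<^sub>R (rank_one B (of_real \<kappa> *s (h *v g)) (of_real \<kappa> *s (h *v g)) - rank_one B q q)"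
proof -
  define v where "v = h *v g"
  define a where "a = Re (B v g)"
  have "B v g = of_real a"
    unfolding a_def using B_commute[of g v] sa[OF h(1), of g g]
    by (intro real_if_cnj_eq[symmetric]) (simp add: v_def)
  then have a: "a \<noteq> 0" using nz by (auto simp: v_def)
  obtain \<beta> where \<beta>: "h = (1 / a) *\<^sub>R rank_one B v v + \<beta> *\<^sub>R rank_one B q q"
    unfolding a_def v_def by (rule split_off_squares[OF h ind q(1-3) nz])
  have "B (h *v p) p = of_real (1 / a) * (B p v * B v p) + of_real \<beta> * (B p q * B q p)"
    by (subst \<beta>) (simp add: matrix_vector_mult_add_rdistrib scaleR_mult_vec rank_one_mult B_simps)
  then have "of_real ((1 / a) * (cmod (B p v))\<^sup>2 + \<beta> * (cmod (B p q))\<^sup>2) = (0 :: complex)"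
    unfolding mult_B_commute p(2)[OF h(1)] by simp
  then have e: "(1 / a) * (cmod (B p v))\<^sup>2 + \<beta> * (cmod (B p q))\<^sup>2 = 0"
    unfolding of_real_eq_0_iff .
  \<comment> \<open>Without the term in \<open>q\<close>, the trace and the condition at
    \<open>p\<close> would make \<open>v\<close> a null vector orthogonal to
    \<open>p\<close>.\<close>
  have \<beta>0: "\<beta> \<noteq> 0"
  proof
    assume b0: "\<beta> = 0"
    then have pv: "B p v = 0" using e a by simp
    have hv: "h = (1 / a) *\<^sub>R rank_one B v v" using \<beta> b0 by simp
    have "trace h = of_real (1 / a) * B v v"
      by (subst hv) (simp add: trace_def sum_distrib_left scaleR_conv_of_real[where 'a=complex] sum_divide_distrib
        flip: trace_rank_one)
    then have "B v v = 0" using tr[OF h(1)] a by simp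
    then have "v = 0" using null_orthogonal_to_negative[OF p(1) pv] by simp
    then show False using nz by (simp add: v_def)
  qed
  have pv: "B p v \<noteq> 0" using e \<beta>0 q(4) by auto
  define \<kappa> where "\<kappa> = cmod (B p q) / cmod (B p v)"
  have \<kappa>: "\<kappa> > 0" using pv q(4) by (simp add: \<kappa>_def)
  have "\<beta> * (cmod (B p q))\<^sup>2 = - (1 / a) * (cmod (B p v))\<^sup>2" using e by simp
  then have "- \<beta> * \<kappa> * \<kappa> = 1 / a"
    using pv by (simp add: \<kappa>_def power2_eq_square field_simps)
  then have "h = (- \<beta>) *\<^sub>R (rank_one B (of_real \<kappa> *s v) (of_real \<kappa> *s v) - rank_one B q q)"
    by (subst \<beta>) (simp add: rank_one_simps algebra_simps)
  then show ?thesis unfolding v_def by (rule that[rotated 2]) (use \<beta>0 \<kappa> in simp_all)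
qed

text \<open>Splitting the coefficients into real and imaginary parts turns a complex relation at
  \<open>f\<close> into the vanishing at \<open>f\<close> of an element of the
  complexification.\<close>

lemma combination_zero:
  assumes nf: "\<And>k1 k2. k1 \<in> W \<Longrightarrow> k2 \<in> W \<Longrightarrow> k1 *v f + \<i> *s (k2 *v f) = 0 \<Longrightarrow> k1 = 0 \<and> k2 = 0"
    and h: "h1 \<in> W" "h2 \<in> W" "h3 \<in> W"
    and e: "r1 *s (h1 *v f) + r2 *s (h2 *v f) + r3 *s (h3 *v f) = 0"
  shows "Re r1 *\<^sub>R h1 + Re r2 *\<^sub>R h2 + Re r3 *\<^sub>R h3 = 0 \<and>
    Im r1 *\<^sub>R h1 + Im r2 *\<^sub>R h2 + Im r3 *\<^sub>R h3 = 0"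
proof (rule nf)
  have "(of_real (Re r1) + \<i> * of_real (Im r1)) *s (h1 *v f) + (of_real (Re r2) + \<i> * of_real (Im r2)) *s (h2 *v f)
    + (of_real (Re r3) + \<i> * of_real (Im r3)) *s (h3 *v f) = 0"
    using e unfolding complex_eq[symmetric] .
  then show "(Re r1 *\<^sub>R h1 + Re r2 *\<^sub>R h2 + Re r3 *\<^sub>R h3) *v f
      + \<i> *s ((Im r1 *\<^sub>R h1 + Im r2 *\<^sub>R h2 + Im r3 *\<^sub>R h3) *v f) = 0"
    by (simp add: matrix_vector_mult_add_rdistrib scaleR_mult_vec vec.scale_left_distrib
      vec.scale_right_distrib add_ac)
qed (use sW h in \<open>simp_all add: subspace_add subspace_scale\<close>)

section \<open>Families with three collinear foci\<close>

lemma orthogonal_to_focus: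
  assumes "h \<in> W" "h *v f = 0"
  shows "B (h *v g) f = 0"
  using sa[OF assms(1), of g f] assms(2) by simp

text \<open>Each \<open>h\<close> is a real multiple of a difference of squares with the same
  subtrahend \<open>rank_one B q q\<close>, as \<open>equitantI\<close> requires; what remains is
  that \<open>q\<close> has no vanishing coordinate in the basis of the \<open>v\<close>.\<close>

lemma equitant_nondegenerate:
  assumes h: "h1 \<in> W" "h2 \<in> W" "h3 \<in> W" and W: "W = span {h1, h2, h3}"
    and hf: "h1 *v f1 = 0" "h2 *v f2 = 0" "h3 *v f3 = 0" and f: "f1 + f2 + f3 = 0"
    and ind: "\<And>a b. a *s f1 + b *s f2 = 0 \<Longrightarrow> a = 0 \<and> b = 0"
      "\<And>a b. a *s f2 + b *s f3 = 0 \<Longrightarrow> a = 0 \<and> b = 0"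
      "\<And>a b. a *s f3 + b *s f1 = 0 \<Longrightarrow> a = 0 \<and> b = 0"
    and v: "indep3 (h1 *v f2) (h2 *v f3) (h3 *v f1)"
    and q: "q \<noteq> 0" "B q f1 = 0" "B q f2 = 0" "B q f3 = 0" "B p q \<noteq> 0"
    and nz: "B (h1 *v f2) f2 \<noteq> 0" "B (h2 *v f3) f3 \<noteq> 0" "B (h3 *v f1) f1 \<noteq> 0"
  shows "equitant B W"
proof -
  obtain s1 \<kappa>1 :: real where 1: "s1 \<noteq> 0" "\<kappa>1 > 0"
    "h1 = s1 *\<^sub>R (rank_one B (of_real \<kappa>1 *s (h1 *v f2)) (of_real \<kappa>1 *s (h1 *v f2)) - rank_one B q q)"
    by (rule split_normalised[OF h(1) hf(1) ind(1) q(1,2,3,5) nz(1)])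
  obtain s2 \<kappa>2 :: real where 2: "s2 \<noteq> 0" "\<kappa>2 > 0"
    "h2 = s2 *\<^sub>R (rank_one B (of_real \<kappa>2 *s (h2 *v f3)) (of_real \<kappa>2 *s (h2 *v f3)) - rank_one B q q)"
    by (rule split_normalised[OF h(2) hf(2) ind(2) q(1,3,4,5) nz(2)])
  obtain s3 \<kappa>3 :: real where 3: "s3 \<noteq> 0" "\<kappa>3 > 0"
    "h3 = s3 *\<^sub>R (rank_one B (of_real \<kappa>3 *s (h3 *v f1)) (of_real \<kappa>3 *s (h3 *v f1)) - rank_one B q q)"
    by (rule split_normalised[OF h(3) hf(3) ind(3) q(1,4,2,5) nz(3)])
  define v1 v2 v3 where v123: "v1 = h1 *v f2" "v2 = h2 *v f3" "v3 = h3 *v f1"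
  obtain c1 c2 c3 where qc: "q = c1 *s v1 + c2 *s v2 + c3 *s v3"
    using v unfolding v123[symmetric] by (rule indep3_span)
  have o: "B v1 f1 = 0" "B v2 f2 = 0" "B v3 f3 = 0"
    unfolding v123 using orthogonal_to_focus h hf by blast+
  have f3: "f3 = - (f1 + f2)" using f by (rule add_eq_0_iff[THEN iffD1])
  have m: "B v1 f3 = - B v1 f2" "B v2 f1 = - B v2 f3" "B v3 f2 = - B v3 f1"
    using o by (simp_all add: f3 B_simps eq_neg_iff_add_eq_0)
  \<comment> \<open>Orthogonality of \<open>q\<close> to \<open>f1\<close> and \<open>f2\<close>
    ties the coordinates together: they vanish simultaneously, which \<open>q\<close> being nonzero
    excludes.\<close>
  have "c2 * B v2 f3 = c3 * B v3 f1" "c1 * B v1 f2 = c3 * B v3 f1"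
    using q(2,3) by (simp_all add: qc B_simps o m)
  moreover have "B v1 f2 \<noteq> 0" "B v2 f3 \<noteq> 0" "B v3 f1 \<noteq> 0" using nz by (simp_all add: v123)
  ultimately have cz: "c1 = 0 \<longleftrightarrow> c3 = 0" "c2 = 0 \<longleftrightarrow> c3 = 0" by (metis mult_eq_0_iff)+
  have c: "c1 \<noteq> 0" "c2 \<noteq> 0" "c3 \<noteq> 0" using cz qc q(1) by auto
  let ?w1 = "of_real \<kappa>1 *s v1" and ?w2 = "of_real \<kappa>2 *s v2" and ?w3 = "of_real \<kappa>3 *s v3"
  have ind': "indep3 ?w1 ?w2 ?w3" unfolding indep3_def
  proof (intro allI impI)
    fix a b c assume "a *s ?w1 + b *s ?w2 + c *s ?w3 = 0"
    then have "(a * of_real \<kappa>1) *s v1 + (b * of_real \<kappa>2) *s v2 + (c * of_real \<kappa>3) *s v3 = 0" by simp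
    then have "a * of_real \<kappa>1 = 0 \<and> b * of_real \<kappa>2 = 0 \<and> c * of_real \<kappa>3 = 0"
      using v unfolding indep3_def v123[symmetric] by blast
    then show "a = 0 \<and> b = 0 \<and> c = 0" using 1(2) 2(2) 3(2) by simp
  qed
  have q': "q = (c1 / of_real \<kappa>1) *s ?w1 + (c2 / of_real \<kappa>2) *s ?w2 + (c3 / of_real \<kappa>3) *s ?w3"
    using 1(2) 2(2) 3(2) qc by simp
  define X where "X = (\<lambda>w. rank_one B w w - rank_one B q q)"
  have hX: "h1 = s1 *\<^sub>R X ?w1" "h2 = s2 *\<^sub>R X ?w2" "h3 = s3 *\<^sub>R X ?w3"
    using 1(3) 2(3) 3(3) unfolding X_def v123 by blast+
  have "W = span {s1 *\<^sub>R X ?w1, s2 *\<^sub>R X ?w2, s3 *\<^sub>R X ?w3}"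
    unfolding W by (rule arg_cong[of _ _ span]) (simp only: hX[symmetric])
  then have W': "W = span {rank_one B ?w1 ?w1 - rank_one B q q, rank_one B ?w2 ?w2 - rank_one B q q,
      rank_one B ?w3 ?w3 - rank_one B q q}"
    unfolding span_scale3[OF 1(1) 2(1) 3(1)] X_def .
  show ?thesis
    by (rule equitantI[OF tr p ind' q' _ _ _ W']) (use c 1(2) 2(2) 3(2) in auto)
qed

text \<open>Here \<open>v1\<close> is a multiple of \<open>q\<close>, and \<open>h1\<close> becomes
  <-, q> u + <-, u> q, a tangent direction at \<open>q\<close>. The other two members split as
  before, and after a change of phase of \<open>q\<close> the span is that of
  \<open>equitant_of_tangent_span\<close>.\<close>

lemma equitant_degenerate:
  assumes h: "h1 \<in> W" "h2 \<in> W" "h3 \<in> W" and W: "W = span {h1, h2, h3}"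
    and hf: "h1 *v f1 = 0" "h2 *v f2 = 0" "h3 *v f3 = 0" and f: "f1 + f2 + f3 = 0"
    and ind: "\<And>a b. a *s f1 + b *s f2 = 0 \<Longrightarrow> a = 0 \<and> b = 0"
      "\<And>a b. a *s f2 + b *s f3 = 0 \<Longrightarrow> a = 0 \<and> b = 0"
      "\<And>a b. a *s f3 + b *s f1 = 0 \<Longrightarrow> a = 0 \<and> b = 0"
    and v: "indep3 (h1 *v f2) (h2 *v f3) (h3 *v f1)"
    and q: "q \<noteq> 0" "B q f1 = 0" "B q f2 = 0" "B q f3 = 0" "B p q \<noteq> 0"
    and deg: "B (h1 *v f2) f2 = 0"
  shows "equitant B W"
proof -
  define v1 v2 v3 where v123: "v1 = h1 *v f2" "v2 = h2 *v f3" "v3 = h3 *v f1"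
  have v': "indep3 v1 v2 v3" using v unfolding v123 .
  have o: "B v1 f1 = 0" "B v2 f2 = 0" "B v3 f3 = 0"
    unfolding v123 using orthogonal_to_focus h hf by blast+
  obtain c where c: "v1 = c *s q"
    using orthogonal_unique[OF ind(1) q(1-3) o(1)] deg unfolding v123 by blast
  have c0: "c \<noteq> 0"
    using v'[unfolded indep3_def, rule_format, of 1 0 0] c by auto
  \<comment> \<open>A second \<open>v\<close> proportional to \<open>q\<close> would be dependent on
    \<open>v1\<close>, so only one can degenerate.\<close>
  have nz2: "B v2 f3 \<noteq> 0"
  proof
    assume "B v2 f3 = 0"
    then obtain d where "v2 = d *s q" using orthogonal_unique[OF ind(2) q(1,3,4) o(2)] by blast
    then show False using v'[unfolded indep3_def, rule_format, of d "- c" 0] c c0 by simp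
  qed
  have nz3: "B v3 f1 \<noteq> 0"
  proof
    assume "B v3 f1 = 0"
    then obtain d where "v3 = d *s q" using orthogonal_unique[OF ind(3) q(1,4,2) o(3)] by blast
    then show False using v'[unfolded indep3_def, rule_format, of d 0 "- c"] c c0 by simp
  qed
  obtain s2 \<kappa>2 :: real where 2: "s2 \<noteq> 0" "\<kappa>2 > 0"
    "h2 = s2 *\<^sub>R (rank_one B (of_real \<kappa>2 *s v2) (of_real \<kappa>2 *s v2) - rank_one B q q)"
    unfolding v123 by (rule split_normalised[OF h(2) hf(2) ind(2) q(1,3,4,5) nz2[unfolded v123]])
  obtain s3 \<kappa>3 :: real where 3: "s3 \<noteq> 0" "\<kappa>3 > 0"
    "h3 = s3 *\<^sub>R (rank_one B (of_real \<kappa>3 *s v3) (of_real \<kappa>3 *s v3) - rank_one B q q)"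
    unfolding v123 by (rule split_normalised[OF h(3) hf(3) ind(3) q(1,4,2,5) nz3[unfolded v123]])
  define x y where xy: "x = of_real \<kappa>2 *s v2" "y = of_real \<kappa>3 *s v3"
  have xyq: "indep3 x y q" unfolding indep3_def
  proof (intro allI impI)
    fix a b e assume e: "a *s x + b *s y + e *s q = 0"
    have "(e / c) *s v1 + (a * of_real \<kappa>2) *s v2 + (b * of_real \<kappa>3) *s v3 = a *s x + b *s y + e *s q"
      using c0 by (simp add: c xy)
    then have "e / c = 0 \<and> a * of_real \<kappa>2 = 0 \<and> b * of_real \<kappa>3 = 0"
      using v'[unfolded indep3_def, rule_format, of "e / c" "a * of_real \<kappa>2" "b * of_real \<kappa>3"] e by simp
    then show "a = 0 \<and> b = 0 \<and> e = 0" using 2(2) 3(2) c0 by simp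
  qed
  have f3: "f3 = - (f1 + f2)" using f by (rule add_eq_0_iff[THEN iffD1])
  have real2: "of_real (Re (B v2 f3)) = B v2 f3"
    using B_commute[of v2 f3] sa[OF h(2), of f3 f3] by (intro real_if_cnj_eq) (simp add: v123)
  have real3: "of_real (Re (B v3 f1)) = B v3 f1"
    using B_commute[of v3 f1] sa[OF h(3), of f1 f1] by (intro real_if_cnj_eq) (simp add: v123)
  have "B v2 f1 = - B v2 f3" using o by (simp add: f3 B_simps eq_neg_iff_add_eq_0)
  then have xf: "B x f1 = - of_real (\<kappa>2 * Re (B v2 f3))"
    by (simp add: xy B_simps real2)
  have yf: "B y f1 = of_real (\<kappa>3 * Re (B v3 f1))"
    by (simp add: xy B_simps real3)
  \<comment> \<open>Minus the ratio of the pairings of \<open>x\<close> and \<open>y\<close> with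
    \<open>f1\<close>, which are real by self-adjointness of \<open>h2\<close> and
    \<open>h3\<close>. As \<open>u\<close> is orthogonal to \<open>f1\<close>, its coordinates along
    \<open>x\<close> and \<open>y\<close> therefore have the real ratio \<rho>.\<close>
  define \<rho> where "\<rho> = \<kappa>2 * Re (B v2 f3) / (\<kappa>3 * Re (B v3 f1))"
  have r2: "Re (B v2 f3) \<noteq> 0" and r3: "Re (B v3 f1) \<noteq> 0"
    using nz2 nz3 real2 real3 by (metis of_real_0)+
  have \<rho>: "\<rho> \<noteq> 0" using r2 r3 2(2) 3(2) by (simp add: \<rho>_def)
  obtain g where g: "B g q = 1"
  proof -
    obtain g0 where "B g0 q \<noteq> 0" using nondegenerate q(1) by blast
    then show ?thesis by (intro that[of "(1 / B g0 q) *s g0"]) (simp add: B_simps)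
  qed
  have fq: "B f1 q = 0" "B f2 q = 0" using q B_eq_0_commute by blast+
  have ig: "indep3 f1 f2 g" unfolding indep3_def
  proof (intro allI impI)
    fix a b e assume s: "a *s f1 + b *s f2 + e *s g = 0"
    have "e = 0" using arg_cong[OF s, of "\<lambda>x. B x q"] by (simp add: B_simps fq g)
    then show "a = 0 \<and> b = 0 \<and> e = 0" using ind(1) s by simp
  qed
  define r where "r = B g (h1 *v g)"
  have cr: "cnj r = r" unfolding r_def using B_commute[of g "h1 *v g"] sa[OF h(1), of g g] by simp
  \<comment> \<open>Half of \<open>r\<close> is removed since at \<open>g\<close> the term <-, u> q
    contributes exactly (r / 2) q; \<open>r\<close> is real by self-adjointness.\<close>
  define u where "u = h1 *v g - (r / 2) *s q"
  have gu: "B g u = r / 2" by (simp add: u_def B_simps g cr flip: r_def)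
  have f1u: "B f1 u = 0"
    using sa[OF h(1), of f1 g] hf(1) by (simp add: u_def B_simps fq)
  have "B q g = 1" using B_commute[of q g] g by simp
  then have f2u: "B f2 u = c"
    using sa[OF h(1), of f2 g] by (simp add: u_def B_simps fq c[unfolded v123])
  have h1u: "h1 = rank_one B q u + rank_one B u q"
  proof (rule cmat_eq_on_basis[OF ig])
    show "h1 *v f1 = (rank_one B q u + rank_one B u q) *v f1"
      by (simp add: hf matrix_vector_mult_add_rdistrib rank_one_mult fq f1u)
    show "h1 *v f2 = (rank_one B q u + rank_one B u q) *v f2"
      by (simp add: c[unfolded v123] matrix_vector_mult_add_rdistrib rank_one_mult fq f2u)
    show "h1 *v g = (rank_one B q u + rank_one B u q) *v g"
      by (simp add: matrix_vector_mult_add_rdistrib rank_one_mult g gu) (simp add: u_def)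
  qed
  obtain \<eta> \<mu> \<nu> where u: "u = \<eta> *s x + \<mu> *s y + \<nu> *s q" using xyq by (rule indep3_span)
  have "B u f1 = 0" using f1u B_eq_0_commute by blast
  then have "\<mu> * of_real (\<kappa>3 * Re (B v3 f1)) = \<eta> * of_real (\<kappa>2 * Re (B v2 f3))"
    by (simp add: u B_simps q(2) xf yf)
  then have \<mu>: "\<mu> = \<eta> * of_real \<rho>"
    using r3 3(2) by (simp add: \<rho>_def field_simps)
  have \<eta>: "\<eta> \<noteq> 0"
  proof
    assume "\<eta> = 0"
    then have "u = \<nu> *s q" using u \<mu> by simp
    then show False using f2u c0 by (simp add: B_simps fq)
  qed
  define z where "z = x + of_real \<rho> *s y"
  have uz: "u = \<eta> *s z + \<nu> *s q" by (simp add: u \<mu> z_def vec.scale_right_distrib)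
  define l where "l = cmod \<eta>"
  have l: "l > 0" using \<eta> by (simp add: l_def)
  \<comment> \<open>The phase of \<eta> is absorbed into \<open>q\<close>, which leaves
    \<open>rank_one B q q\<close> unchanged and replaces \<eta> by the positive real
    \<open>l\<close>.\<close>
  define \<omega> where "\<omega> = cnj \<eta> / of_real l"
  have l\<omega>: "of_real l * \<omega> = cnj \<eta>" "of_real l * cnj \<omega> = \<eta>" using l by (simp_all add: \<omega>_def)
  have "of_real l * of_real l = \<eta> * cnj \<eta>"
    using complex_norm_square[of \<eta>] by (simp add: l_def power2_eq_square)
  then have \<omega>: "\<omega> * cnj \<omega> = 1" using l \<eta> by (simp add: \<omega>_def mult.commute)
  define q' where "q' = \<omega> *s q"
  have qq: "rank_one B q' q' = rank_one B q q"
    by (rule cmat_eqI) (use \<omega> in \<open>simp add: rank_one_mult q'_def B_simps mult.commute mult.left_commute\<close>)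
  define t where "t = 2 * Re \<nu> / l"
  have \<nu>: "\<nu> + cnj \<nu> = of_real (l * t)" using l by (simp add: t_def complex_eq_iff)
  have H1: "h1 = l *\<^sub>R (rank_one B q' z + rank_one B z q' + t *\<^sub>R rank_one B q' q')"
  proof (rule cmat_eqI)
    fix a
    have "h1 *v a = (\<eta> * B a q) *s z + (cnj \<eta> * B a z) *s q + ((\<nu> + cnj \<nu>) * B a q) *s q"
      unfolding h1u uz
      by (simp add: matrix_vector_mult_add_rdistrib rank_one_mult B_simps vec.scale_left_distrib
        vec.scale_right_distrib algebra_simps)
    also have "\<dots> = (of_real l * cnj \<omega> * B a q) *s z + (of_real l * \<omega> * B a z) *s q + (of_real (l * t) * B a q) *s q"
      unfolding \<nu> l\<omega> ..
    also have "\<dots> = (l *\<^sub>R (rank_one B q' z + rank_one B z q' + t *\<^sub>R rank_one B q' q')) *v a"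
      unfolding qq by (simp add: matrix_vector_mult_add_rdistrib rank_one_mult scaleR_mult_vec q'_def B_simps
        vec.scale_right_distrib algebra_simps)
    finally show "h1 *v a = (l *\<^sub>R (rank_one B q' z + rank_one B z q' + t *\<^sub>R rank_one B q' q')) *v a" .
  qed
  have \<omega>0: "\<omega> \<noteq> 0" using \<omega> by auto
  have xyq': "indep3 x y q'" unfolding indep3_def
  proof (intro allI impI)
    fix a b e assume "a *s x + b *s y + e *s q' = 0"
    then have "a *s x + b *s y + (e * \<omega>) *s q = 0" by (simp add: q'_def)
    then have "a = 0 \<and> b = 0 \<and> e * \<omega> = 0" using xyq unfolding indep3_def by blast
    then show "a = 0 \<and> b = 0 \<and> e = 0" using \<omega>0 by simp
  qed
  let ?X = "rank_one B x x - rank_one B q' q'" and ?Y = "rank_one B y y - rank_one B q' q'"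
    and ?T = "rank_one B q' z + rank_one B z q' + t *\<^sub>R rank_one B q' q'"
  have H23: "h2 = s2 *\<^sub>R ?X" "h3 = s3 *\<^sub>R ?Y" using 2(3) 3(3) by (simp_all only: qq xy)
  have "W = span {h2, h3, h1}" unfolding W by (simp add: insert_commute)
  also have "\<dots> = span {?X, ?Y, ?T}"
    unfolding H1 H23 using span_scale3[OF 2(1) 3(1), of l ?X ?Y ?T] l by simp
  finally have WX: "W = span {?X, ?Y, ?T}" .
  show ?thesis
    by (rule equitant_of_tangent_span[OF tr p xyq' \<rho> z_def WX])
qed

text \<open>The vectors \<open>h1 g\<close>, \<open>h2 g\<close>, \<open>h3 g\<close> are multiples
  of \<open>v1\<close>, \<open>v2\<close>, \<open>v3\<close>, and \<open>nf\<close> turns complex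
  relations among them into real relations among \<open>h1\<close>, \<open>h2\<close>,
  \<open>h3\<close>. This yields the bases of \<open>W\<close> and \<open>V\<close>.\<close>

lemma equitant_of_collinear_foci:
  assumes dW: "dim W = 3"
    and h: "h1 \<in> W" "h2 \<in> W" "h3 \<in> W"
    and hf: "h1 *v f1 = 0" "h2 *v f2 = 0" "h3 *v f3 = 0" and f: "f1 + f2 + f3 = 0"
    and ind1: "\<And>a b. a *s f1 + b *s f2 = 0 \<Longrightarrow> a = 0 \<and> b = 0"
    and rind: "\<And>a b :: real. a *\<^sub>R h1 + b *\<^sub>R h2 = 0 \<Longrightarrow> a = 0 \<and> b = 0"
      "\<And>a b :: real. a *\<^sub>R h1 + b *\<^sub>R h3 = 0 \<Longrightarrow> a = 0 \<and> b = 0"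
      "\<And>a b :: real. a *\<^sub>R h2 + b *\<^sub>R h3 = 0 \<Longrightarrow> a = 0 \<and> b = 0"
    and g: "g = x *s f1 + y *s f2" "g \<noteq> 0"
    and nf: "\<And>k1 k2. k1 \<in> W \<Longrightarrow> k2 \<in> W \<Longrightarrow> k1 *v g + \<i> *s (k2 *v g) = 0 \<Longrightarrow> k1 = 0 \<and> k2 = 0"
  shows "equitant B W"
proof -
  have f3: "f3 = - (f1 + f2)" using f by (rule add_eq_0_iff[THEN iffD1])
  have ind2: "a = 0 \<and> b = 0" if e: "a *s f2 + b *s f3 = 0" for a b
  proof -
    have "(- b) *s f1 + (a - b) *s f2 = a *s f2 + b *s f3"
      by (simp add: f3 vec.scale_right_distrib vec.scale_left_diff_distrib vec.scale_right_diff_distrib)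
    then have "- b = 0 \<and> a - b = 0" unfolding e by (rule ind1)
    then show ?thesis by simp
  qed
  have ind3: "a = 0 \<and> b = 0" if e: "a *s f3 + b *s f1 = 0" for a b
  proof -
    have "(b - a) *s f1 + (- a) *s f2 = a *s f3 + b *s f1"
      by (simp add: f3 vec.scale_right_distrib vec.scale_left_diff_distrib vec.scale_right_diff_distrib)
    then have "b - a = 0 \<and> - a = 0" unfolding e by (rule ind1)
    then show ?thesis by simp
  qed
  have hne: "h1 \<noteq> 0" "h2 \<noteq> 0" "h3 \<noteq> 0"
    using rind(1)[of 1 0] rind(1)[of 0 1] rind(2)[of 0 1] by auto
  have zero: "k = 0" if "k \<in> W" "k *v g = 0" for k
    using nf[of k 0] that sW by (simp add: subspace_0)
  define v1 v2 v3 where v123: "v1 = h1 *v f2" "v2 = h2 *v f3" "v3 = h3 *v f1"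
  have h2f1: "h2 *v f1 = - v2"
    using hf(2) by (simp add: v123 f3 vec.add vec.neg vec.diff)
  have h3f2: "h3 *v f2 = - v3"
  proof -
    have "h3 *v f3 = - (h3 *v f1) - h3 *v f2" by (simp add: f3 vec.neg vec.add vec.diff)
    then show ?thesis using hf(3) by (simp add: v123)
  qed
  have hg: "h1 *v g = y *s v1" "h2 *v g = (- x) *s v2" "h3 *v g = (x - y) *s v3"
    by (simp_all add: g(1) vec.add vec.scale hf h2f1 h3f2 vec.scale_left_diff_distrib flip: v123)
  \<comment> \<open>No \<open>h\<close> kills \<open>g\<close>, so none of the coefficients in
    \<open>hg\<close> vanishes.\<close>
  have xy: "x \<noteq> 0" "y \<noteq> 0" "x - y \<noteq> 0"
    using zero[OF h(1)] zero[OF h(2)] zero[OF h(3)] hne hg by auto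
  have cz: "Re r1 *\<^sub>R h1 + Re r2 *\<^sub>R h2 + Re r3 *\<^sub>R h3 = 0 \<and>
      Im r1 *\<^sub>R h1 + Im r2 *\<^sub>R h2 + Im r3 *\<^sub>R h3 = 0"
    if "r1 *s (h1 *v g) + r2 *s (h2 *v g) + r3 *s (h3 *v g) = 0" for r1 r2 r3
    by (rule combination_zero[OF nf h that])
  have tri: "a = 0 \<and> b = 0 \<and> c = 0" if e: "a *\<^sub>R h1 + b *\<^sub>R h2 + c *\<^sub>R h3 = 0" for a b c :: real
  proof (cases "c = 0")
    case True then show ?thesis using rind(1) e by simp
  next
    case False
    \<comment> \<open>If \<open>h3\<close> is a real combination of \<open>h1\<close> and
      \<open>h2\<close>, evaluation at \<open>f3\<close> relates \<open>v1\<close> to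
      \<open>v2\<close>. Then \<open>a' x h1 + b' y h2\<close> kills \<open>g\<close>, and
      independence of \<open>h1\<close> and \<open>h2\<close> forces \<open>x = 0\<close>.\<close>
    define a' b' where ab: "a' = - a / c" "b' = - b / c"
    have "h3 = (1 / c) *\<^sub>R (c *\<^sub>R h3)" using False by simp
    also have "c *\<^sub>R h3 = (- a) *\<^sub>R h1 + (- b) *\<^sub>R h2"
      using e by (simp add: eq_neg_iff_add_eq_0 algebra_simps)
    finally have h3: "h3 = a' *\<^sub>R h1 + b' *\<^sub>R h2"
      by (simp add: ab scaleR_add_right scaleR_diff_right)
    have a': "a' \<noteq> 0" using rind(3)[of b' "-1"] h3 by auto
    have b': "b' \<noteq> 0" using rind(2)[of a' "-1"] h3 by auto
    have "h1 *v f3 = - v1" by (simp add: f3 v123 vec.neg vec.add vec.diff hf)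
    then have "h3 *v f3 = - (of_real a' *s v1 - of_real b' *s v2)"
      by (subst h3) (simp add: matrix_vector_mult_add_rdistrib scaleR_mult_vec v123)
    then have v: "of_real a' *s v1 = of_real b' *s v2" using hf(3) by simp
    have "(of_real a' * x) *s (h1 *v g) + (of_real b' * y) *s (h2 *v g) + 0 *s (h3 *v g)
      = (x * y) *s (of_real a' *s v1) - (x * y) *s (of_real b' *s v2)"
      unfolding hg by (simp add: mult.commute mult.left_commute)
    then have "(of_real a' * x) *s (h1 *v g) + (of_real b' * y) *s (h2 *v g) + 0 *s (h3 *v g) = 0"
      unfolding v by simp
    from cz[OF this]
    have "(a' * Re x) *\<^sub>R h1 + (b' * Re y) *\<^sub>R h2 = 0" "(a' * Im x) *\<^sub>R h1 + (b' * Im y) *\<^sub>R h2 = 0"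
      by simp_all
    then have "a' * Re x = 0" "a' * Im x = 0" using rind(1) by blast+
    then have "x = 0" using a' by (simp add: complex_eq_iff)
    then show ?thesis using xy by simp
  qed
  have v: "indep3 v1 v2 v3" unfolding indep3_def
  proof (intro allI impI)
    fix a b c assume e: "a *s v1 + b *s v2 + c *s v3 = 0"
    have "(a / y) *s (h1 *v g) + (- b / x) *s (h2 *v g) + (c / (x - y)) *s (h3 *v g) = 0"
    proof -
      have "a / y * y = a" "- b / x * - x = b" "c / (x - y) * (x - y) = c" using xy by simp_all
      then show ?thesis unfolding hg vec.scale_scale using e by (simp only:)
    qed
    from cz[OF this]
    have "Re (a / y) = 0 \<and> Re (- b / x) = 0 \<and> Re (c / (x - y)) = 0"
      "Im (a / y) = 0 \<and> Im (- b / x) = 0 \<and> Im (c / (x - y)) = 0"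
      using tri by blast+
    then have "a / y = 0" "- b / x = 0" "c / (x - y) = 0"
      unfolding complex_eq_iff zero_complex.sel by blast+
    then show "a = 0 \<and> b = 0 \<and> c = 0" using xy by simp
  qed
  have W: "W = span {h1, h2, h3}"
  proof
    show "span {h1, h2, h3} \<subseteq> W" using h sW by (intro span_minimal) auto
    show "W \<subseteq> span {h1, h2, h3}"
      using real_vector.independent_tripleI[of h1 h2 h3, OF tri] h dW
      by (intro card_ge_dim_independent) auto
  qed
  obtain q where q: "q \<noteq> 0" "B q f1 = 0" "B q f2 = 0" by (rule exists_orthogonal)
  have qf3: "B q f3 = 0" using q by (simp add: f3 B_simps)
  have o: "B v1 f1 = 0" "B v2 f2 = 0" "B v3 f3 = 0"
    unfolding v123 using orthogonal_to_focus h hf by blast+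
  have pq: "B p q \<noteq> 0"
  proof
    assume pq: "B p q = 0"
    \<comment> \<open>Either \<open>k g'\<close> is a multiple of \<open>q\<close>, or
      \<open>k\<close> splits into two squares of which only that of \<open>k g'\<close> contributes
      at \<open>p\<close>. In both cases \<open>p\<close> is orthogonal to \<open>k g'\<close>;
      applied to \<open>v1\<close>, \<open>v2\<close>, \<open>v3\<close> this gives
      \<open>p = 0\<close>.\<close>
    have *: "B p (k *v g') = 0"
      if k: "k \<in> W" "k *v f' = 0" and i: "\<And>a b. a *s f' + b *s g' = 0 \<Longrightarrow> a = 0 \<and> b = 0"
        and q': "B q f' = 0" "B q g' = 0" for k f' g'
    proof (cases "B (k *v g') g' = 0")
      case True
      then obtain c where "k *v g' = c *s q"
        using orthogonal_unique[OF i q(1) q' orthogonal_to_focus[OF k]] by blast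
      then show ?thesis using pq by (simp add: B_simps)
    next
      case False
      obtain \<beta> where \<beta>: "k = (1 / Re (B (k *v g') g')) *\<^sub>R rank_one B (k *v g') (k *v g') + \<beta> *\<^sub>R rank_one B q q"
        by (rule split_off_squares[OF k i q(1) q' False])
      have "of_real (Re (B (k *v g') g')) = B (k *v g') g'"
        using B_commute[of g' "k *v g'"] sa[OF k(1), of g' g'] by (intro real_if_cnj_eq) simp
      then have r: "Re (B (k *v g') g') \<noteq> 0" using False by (metis of_real_0)
      have "B (k *v p) p = of_real (1 / Re (B (k *v g') g')) * (B p (k *v g') * B (k *v g') p)"
        by (subst \<beta>) (simp add: matrix_vector_mult_add_rdistrib scaleR_mult_vec rank_one_mult B_simps pq)
      then have "B p (k *v g') * B (k *v g') p = 0" using p(2)[OF k(1)] r by simp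
      then show ?thesis using B_eq_0_commute[of p "k *v g'"] by auto
    qed
    have "B p v1 = 0" "B p v2 = 0" "B p v3 = 0"
      unfolding v123 using *[OF h(1) hf(1) ind1 q(2,3)] *[OF h(2) hf(2) ind2 q(3) qf3]
        *[OF h(3) hf(3) ind3 qf3 q(2)] by blast+
    then have "p = 0" using indep3_orthogonal[OF v] by blast
    then show False using p(1) by simp
  qed
  \<comment> \<open>The hypotheses are invariant under cyclic relabelling, which moves a degenerate
    \<open>v\<close> to the first place.\<close>
  have rot: "indep3 v2 v3 v1" "indep3 v3 v1 v2"
    using indep3_rotate[OF v] indep3_rotate[OF indep3_rotate[OF v]] by blast+
  have f': "f2 + f3 + f1 = 0" "f3 + f1 + f2 = 0" using f by (simp_all add: add_ac)
  have W': "W = span {h2, h3, h1}" "W = span {h3, h1, h2}" using W by (simp_all add: insert_commute)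
  show ?thesis
  proof (cases "B v1 f2 = 0 \<or> B v2 f3 = 0 \<or> B v3 f1 = 0")
    case True
    then show ?thesis
    proof (elim disjE)
      assume z: "B v1 f2 = 0"
      show ?thesis
        by (rule equitant_degenerate[OF h W hf f ind1 ind2 ind3 v[unfolded v123] q qf3 pq z[unfolded v123]])
    next
      assume z: "B v2 f3 = 0"
      show ?thesis
        by (rule equitant_degenerate[OF h(2,3,1) W'(1) hf(2,3,1) f'(1) ind2 ind3 ind1
          rot(1)[unfolded v123] q(1,3) qf3 q(2) pq z[unfolded v123]])
    next
      assume z: "B v3 f1 = 0"
      show ?thesis
        by (rule equitant_degenerate[OF h(3,1,2) W'(2) hf(3,1,2) f'(2) ind3 ind1 ind2
          rot(2)[unfolded v123] q(1) qf3 q(2,3) pq z[unfolded v123]])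
    qed
  next
    case False
    then show ?thesis unfolding v123
      by (intro equitant_nondegenerate[OF h W hf f ind1 ind2 ind3 v[unfolded v123] q qf3 pq]) simp_all
  qed
qed

end

end

section \<open>From points of the cubic to collinear kernel vectors\<close>

lemma E_cubic_point:
  assumes "a \<in> E_cubic W"
  obtains h where "h \<in> W" "h \<noteq> 0" "a = range (\<lambda>c::real. c *\<^sub>R h)"
  using assms unfolding E_cubic_def proj_space_def by blast

lemma distinct_points_independent:
  assumes "range (\<lambda>c::real. c *\<^sub>R h) \<noteq> range (\<lambda>c. c *\<^sub>R (k::cmat))" "h \<noteq> 0" "k \<noteq> 0"
    and e: "a *\<^sub>R h + b *\<^sub>R k = 0"
  shows "a = 0 \<and> b = 0"
proof -
  have "a = 0"
  proof (rule ccontr)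
    assume a: "a \<noteq> 0"
    have "h = (1 / a) *\<^sub>R (a *\<^sub>R h)" using a by simp
    also have "a *\<^sub>R h = (- b) *\<^sub>R k" using e by (simp add: eq_neg_iff_add_eq_0)
    finally have h: "h = (- b / a) *\<^sub>R k" by simp
    define r where "r = - b / a"
    have hr: "h = r *\<^sub>R k" unfolding r_def by (rule h)
    then have r: "r \<noteq> 0" using assms(2) by auto
    have "range (\<lambda>c::real. c *\<^sub>R h) = range (\<lambda>c. c *\<^sub>R k)"
    proof (intro subset_antisym image_subsetI)
      fix c :: real
      show "c *\<^sub>R h \<in> range (\<lambda>c. c *\<^sub>R k)" unfolding hr by (rule range_eqI[of _ _ "c * r"]) simp
      show "c *\<^sub>R k \<in> range (\<lambda>c. c *\<^sub>R h)"
        unfolding hr by (rule range_eqI[of _ _ "c / r"]) (use r in simp)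
    qed
    then show False using assms(1) by simp
  qed
  then show ?thesis using e assms(3) by simp
qed

context indefinite_form
begin

lemma real_imp_equitant:
  assumes "real_family B W"
  shows "equitant B W"
proof -
  have gen: "generic B W" using assms by (simp add: real_family_def)
  have nc: "\<not> has_confocal_line W" and ell: "elliptic B W" using gen by (simp_all add: generic_def)
  have dW: "dim W = 3" and fam: "bisector_family B W" using ell by (simp_all add: elliptic_def)
  have sW: "subspace W" using fam by (simp add: bisector_family_def)
  have tr: "\<And>h. h \<in> W \<Longrightarrow> trace h = 0" using fam unfolding bisector_family_def by blast
  have sa: "\<And>h x y. h \<in> W \<Longrightarrow> B (h *v x) y = B x (h *v y)"
    using fam unfolding bisector_family_def is_adjoint_def by blast
  obtain p where p: "Re (B p p) < 0" "\<And>h. h \<in> W \<Longrightarrow> B (h *v p) p = 0"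
    using fam unfolding bisector_family_def by blast
  obtain a1 a2 a3 L where a: "a1 \<in> E_cubic W" "a2 \<in> E_cubic W" "a3 \<in> E_cubic W"
      "a1 \<noteq> a2" "a1 \<noteq> a3" "a2 \<noteq> a3"
    and L: "vec.subspace L" "vec.dim L = 2"
      "focus a1 \<in> PC L" "focus a2 \<in> PC L" "focus a3 \<in> PC L" "\<not> PC L \<subseteq> focal_cubic W"
    using assms unfolding real_family_def by (elim conjE bexE exE)
  obtain h1 where h1: "h1 \<in> W" "h1 \<noteq> 0" "a1 = range (\<lambda>c::real. c *\<^sub>R h1)" using a(1) by (rule E_cubic_point)
  obtain h2 where h2: "h2 \<in> W" "h2 \<noteq> 0" "a2 = range (\<lambda>c::real. c *\<^sub>R h2)" using a(2) by (rule E_cubic_point)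
  obtain h3 where h3: "h3 \<in> W" "h3 \<noteq> 0" "a3 = range (\<lambda>c::real. c *\<^sub>R h3)" using a(3) by (rule E_cubic_point)
  have foc: "\<exists>f. f \<in> L \<and> f \<noteq> 0 \<and> h *v f = 0" if "focus (range (\<lambda>c::real. c *\<^sub>R h)) \<in> PC L" for h
  proof -
    have "\<exists>f. f \<in> L \<and> f \<noteq> 0 \<and> {x. h *v x = 0} = range (\<lambda>c. c *s f)"
      using that unfolding focus_real_point proj_space_def by blast
    then obtain f where f: "f \<in> L" "f \<noteq> 0" "{x. h *v x = 0} = range (\<lambda>c. c *s f)" by (elim exE conjE)
    have "1 *s f \<in> range (\<lambda>c. c *s f)" by (rule rangeI)
    then have "h *v f = 0" unfolding f(3)[symmetric] by simp
    then show ?thesis using f by blast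
  qed
  obtain f1 where f1: "f1 \<in> L" "f1 \<noteq> 0" "h1 *v f1 = 0" using foc L(3) unfolding h1(3) by blast
  obtain f2 where f2: "f2 \<in> L" "f2 \<noteq> 0" "h2 *v f2 = 0" using foc L(4) unfolding h2(3) by blast
  obtain f3 where f3: "f3 \<in> L" "f3 \<noteq> 0" "h3 *v f3 = 0" using foc L(5) unfolding h3(3) by blast
  note r12 = distinct_points_independent[OF a(4)[unfolded h1(3) h2(3)] h1(2) h2(2)]
  note r13 = distinct_points_independent[OF a(5)[unfolded h1(3) h3(3)] h1(2) h3(2)]
  note r23 = distinct_points_independent[OF a(6)[unfolded h2(3) h3(3)] h2(2) h3(2)]
  \<comment> \<open>Proportional kernel vectors of two independent members would produce a confocal
    line.\<close>
  have distinct_foci: "g \<noteq> c *s f"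
    if "h \<in> W" "k \<in> W" "\<And>a b :: real. a *\<^sub>R h + b *\<^sub>R k = 0 \<Longrightarrow> a = 0 \<and> b = 0"
      "f \<noteq> 0" "h *v f = 0" "g \<noteq> 0" "k *v g = 0" for h k f g c
  proof
    assume g: "g = c *s f"
    then have "c \<noteq> 0" using that(6) by auto
    moreover have "c *s (k *v f) = 0" using that(7) unfolding g by (simp add: vec.scale)
    ultimately have "k *v f = 0" by simp
    then show False using confocalI[OF sW that(1-5)] nc by blast
  qed
  have i12: "a = 0 \<and> b = 0" if "a *s f1 + b *s f2 = 0" for a b
    by (rule independent_pair_if_not_multiple[OF f1(2) distinct_foci[OF h1(1) h2(1) r12 f1(2,3) f2(2,3)] that])
  have ind: "vec.independent {f1, f2}" "card {f1, f2} = 2"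
    using vec.independent_pairI[of f1 f2, OF i12] by blast+
  have "L \<subseteq> vec.span {f1, f2}"
    by (rule vec.card_ge_dim_independent) (use f1 f2 ind L(2) in auto)
  then have Lspan: "\<exists>k l. x = k *s f1 + l *s f2" if "x \<in> L" for x
    using that unfolding vec.span_pair_iff[symmetric] by blast
  obtain \<alpha> \<beta> where ab: "f3 = \<alpha> *s f1 + \<beta> *s f2" using Lspan[OF f3(1)] by blast
  have "\<alpha> \<noteq> 0"
    using distinct_foci[OF h2(1) h3(1) r23 f2(2,3) f3(2,3), of \<beta>] ab by auto
  moreover have "\<beta> \<noteq> 0"
    using distinct_foci[OF h1(1) h3(1) r13 f1(2,3) f3(2,3), of \<alpha>] ab by auto
  ultimately have ab0: "\<alpha> \<noteq> 0" "\<beta> \<noteq> 0" by simp_all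
  \<comment> \<open>Rescaled representatives with \<open>g1 + g2 + f3 = 0\<close>; both factors are
    nonzero because the three foci are pairwise distinct.\<close>
  define g1 g2 where g12: "g1 = (- \<alpha>) *s f1" "g2 = (- \<beta>) *s f2"
  have kill: "h1 *v g1 = 0" "h2 *v g2 = 0" using f1(3) f2(3) unfolding g12 vec.scale by simp_all
  have sum0: "g1 + g2 + f3 = 0" by (simp add: g12 ab)
  have ig: "a = 0 \<and> b = 0" if "a *s g1 + b *s g2 = 0" for a b
  proof -
    have "(a * - \<alpha>) *s f1 + (b * - \<beta>) *s f2 = 0" using that unfolding g12 vec.scale_scale .
    then have "a * - \<alpha> = 0 \<and> b * - \<beta> = 0" by (rule i12)
    then show ?thesis using ab0 by simp
  qed
  obtain f where f: "f \<in> L" "f \<noteq> 0" "range (\<lambda>c. c *s f) \<notin> focal_cubic W"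
    using L(6) unfolding proj_space_def by blast
  obtain x y where xy: "f = x *s f1 + y *s f2" using Lspan[OF f(1)] by blast
  have fg: "f = (- x / \<alpha>) *s g1 + (- y / \<beta>) *s g2"
    unfolding g12 vec.scale_scale using ab0 xy by simp
  have nf: "k1 = 0 \<and> k2 = 0" if "k1 \<in> W" "k2 \<in> W" "k1 *v f + \<i> *s (k2 *v f) = 0" for k1 k2
    by (rule not_focus_imp_zero[OF sW tr sa p nc f(2,3) that])
  show ?thesis
    by (rule equitant_of_collinear_foci[OF sW tr sa p dW h1(1) h2(1) h3(1) kill f3(3) sum0 ig r12 r13 r23 fg f(2) nf])
qed

end

theorem proposition1p2p9:
  fixes B :: "complex^3 \<Rightarrow> complex^3 \<Rightarrow> complex"
    and W :: "(complex^3^3) set"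
  assumes "hermitian_form B"
    and "signature_ppm B"
    and "elliptic B W"
  shows "equitant B W \<longleftrightarrow> real_family B W"
proof -
  interpret indefinite_form B by (unfold_locales) (rule assms(1,2))+
  show ?thesis using equitant_imp_real real_imp_equitant assms(3) by blast
qed

end
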